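(* Let $\gamma,\varepsilon,\theta_0>0$, $L>0$, let $N$ be a positive integer, $h=L/N$, and let $s>0$. Let $\phi^n\in\mathcal{C}_\Omega$ be given with $\|\phi^n\|_\infty\le M$ for some constant $M>0$ and with mean value $\overline{\phi^n}=:\beta\in(-1,1)$, where $\overline{\phi^n}=\frac{1}{|\Omega|}(\phi^n,1)$. Then there exists a unique $\phi^{n+1}\in\mathcal{C}_\Omega$ which solves the fully discrete scheme $$\phi^{n+1}-\phi^{n}=s\Delta_h\mu^{n+1}-s\nabla_h\cdot(A_h\phi^n\,\boldsymbol{u}^{n+1}),$$ $$\mu^{n+1}=\ln(1+\phi^{n+1})-\ln(1-\phi^{n+1})-\theta_0\phi^n-\varepsilon^2\Delta_h\phi^{n+1},$$ $$(-\Delta_h+I)\boldsymbol{u}^{n+1}+\nabla_h p^{n+1}+\gamma A_h\phi^n\,\nabla_h\mu^{n+1}=0,$$ $$\nabla_h\cdot\boldsymbol{u}^{n+1}=0$$ (together with some $\mu^{n+1},p^{n+1}\in\mathcal{C}_\Omega$ and $\boldsymbol{u}^{n+1}\in\mathcal{E}_\Omega$, where $\phi^{n+1},\mu^{n+1},p^{n+1}$ satisfy discrete homogeneous Neumann boundary conditions and $\boldsymbol{u}^{n+1}$ satisfies discrete no-penetration and free-slip boundary conditions), with $(\phi^{n+1}-\phi^n,1)=0$ and $\|\phi^{n+1}\|_\infty<1$.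
   Context: Grid functions. $\Omega=(0,L)^3$, $h=L/N$. $\mathcal{C}_\Omega$ is the set of cell-centered functions $\phi=(\phi_{i,j,k})$, $0\le i,j,k\le N+1$, with $\phi_{i,j,k}$ located at $((i-\frac12)h,(j-\frac12)h,(k-\frac12)h)$; cells with all indices in $\{1,\dots,N\}$ are interior, the others are ghost cells. $\mathcal{E}^x_\Omega$ is the set of functions $f_{i+\frac12,j,k}$, $0\le i\le N$, $1\le j,k\le N$, located at $(ih,(j-\frac12)h,(k-\frac12)h)$; $\mathcal{E}^y_\Omega,\mathcal{E}^z_\Omega$ are analogous, and $\mathcal{E}_\Omega=\mathcal{E}^x_\Omega\times\mathcal{E}^y_\Omega\times\mathcal{E}^z_\Omega$. Each component of a field in $\mathcal{E}_\Omega$ is also given ghost values (index $0$ and $N+1$) in its two tangential directions when free-slip conditions are imposed. Boundary conditions. Homogeneous Neumann for $\phi\in\mathcal{C}_\Omega$: $\phi_{0,j,k}=\phi_{1,j,k}$, $\phi_{N,j,k}=\phi_{N+1,j,k}$, and likewise in $j$ and $k$. No-penetration for $\boldsymbol{f}=(f^x,f^y,f^z)\in\mathcal{E}_\Omega$: $f^x_{1/2,j,k}=f^x_{N+1/2,j,k}=0$, and likewise for $f^y$ in $j$ and $f^z$ in $k$. Free-slip: $f^x_{i+1/2,0,k}=f^x_{i+1/2,1,k}$, $f^x_{i+1/2,N+1,k}=f^x_{i+1/2,N,k}$, $f^x_{i+1/2,j,0}=f^x_{i+1/2,j,1}$, $f^x_{i+1/2,j,N+1}=f^x_{i+1/2,j,N}$,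 and likewise for $f^y,f^z$ in their tangential directions. Operators. $d_xf_{i,j,k}=\frac1h(f_{i+\frac12,j,k}-f_{i-\frac12,j,k})$, $\nabla_h\cdot\boldsymbol{f}=d_xf^x+d_yf^y+d_zf^z$; $A_x\phi_{i+\frac12,j,k}=\frac12(\phi_{i+1,j,k}+\phi_{i,j,k})$, $A_h\phi=(A_x\phi,A_y\phi,A_z\phi)^T$; $D_x\phi_{i+\frac12,j,k}=\frac1h(\phi_{i+1,j,k}-\phi_{i,j,k})$, $\nabla_h\phi=(D_x\phi,D_y\phi,D_z\phi)^T$; $\Delta_h\phi=\nabla_h\cdot\nabla_h\phi$ for cell-centered $\phi$; on face-centered components $\Delta_h$ is the standard 7-point Laplacian on the corresponding staggered grid. Products such as $A_h\phi\,\boldsymbol{u}$ and $A_h\phi\,\nabla_h\mu$ are componentwise. Cell-centered equations hold at interior cells; the vector (Stokes) equation holds at faces not lying on $\partial\Omega$ (on boundary faces the normal component is prescribed by no-penetration). Inner product and norm. $(\phi,\psi)=h^3\sum_{i,j,k=1}^N\phi_{i,j,k}\psi_{i,j,k}$; $\|\phi\|_\infty=\max|\phi_{i,j,k}|$ over interior cells. *)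

theory Defs
  imports Complex_Main "HOL-Library.FuncSet"
begin

text \<open>
  Half-integer indices are encoded by rounding down: the value \<open>f (i, j, k)\<close> of an \<open>x\<close>-face
  function is the one at the face \<open>(i + 1/2, j, k)\<close>, and similarly for \<open>y\<close>- and \<open>z\<close>-faces.
  An index \<open>i - 1/2\<close> thus becomes \<open>i - 1\<close>; truncated subtraction never matters, since the
  operators are only used at points where the index in question is at least 1.
\<close>

type_synonym grid = "nat \<times> nat \<times> nat \<Rightarrow> real"
type_synonym vfield = "grid \<times> grid \<times> grid"

definition interior_cells :: "nat \<Rightarrow> (nat \<times> nat \<times> nat) set" where
  "interior_cells N = {1..N} \<times> {1..N} \<times> {1..N}"

text \<open>Extensional function sets make equality of grid functions the same as equality of their
  values on the grid, ghost values included.\<close>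

definition cell_funs :: "nat \<Rightarrow> grid set" where
  "cell_funs N = ({0..N+1} \<times> {0..N+1} \<times> {0..N+1}) \<rightarrow>\<^sub>E UNIV"

definition face_funs_x :: "nat \<Rightarrow> grid set" where
  "face_funs_x N = ({0..N} \<times> {0..N+1} \<times> {0..N+1}) \<rightarrow>\<^sub>E UNIV"

definition face_funs_y :: "nat \<Rightarrow> grid set" where
  "face_funs_y N = ({0..N+1} \<times> {0..N} \<times> {0..N+1}) \<rightarrow>\<^sub>E UNIV"

definition face_funs_z :: "nat \<Rightarrow> grid set" where
  "face_funs_z N = ({0..N+1} \<times> {0..N+1} \<times> {0..N}) \<rightarrow>\<^sub>E UNIV"

definition face_fields :: "nat \<Rightarrow> vfield set" where
  "face_fields N = face_funs_x N \<times> face_funs_y N \<times> face_funs_z N"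

text \<open>Faces not lying on the boundary of \<open>\<Omega>\<close>.\<close>

definition inner_faces_x :: "nat \<Rightarrow> (nat \<times> nat \<times> nat) set" where
  "inner_faces_x N = {1..<N} \<times> {1..N} \<times> {1..N}"

definition inner_faces_y :: "nat \<Rightarrow> (nat \<times> nat \<times> nat) set" where
  "inner_faces_y N = {1..N} \<times> {1..<N} \<times> {1..N}"

definition inner_faces_z :: "nat \<Rightarrow> (nat \<times> nat \<times> nat) set" where
  "inner_faces_z N = {1..N} \<times> {1..N} \<times> {1..<N}"

text \<open>The tangential indices range over ghost indices too, so that the edge and corner ghost
  values of a cell-centered function are determined by its interior values.\<close>

definition neumann_bc :: "nat \<Rightarrow> grid \<Rightarrow> bool" where
  "neumann_bc N \<phi> \<longleftrightarrow>
    (\<forall>a\<in>{0..N+1}. \<forall>b\<in>{0..N+1}.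
      \<phi> (0, a, b) = \<phi> (1, a, b) \<and> \<phi> (N, a, b) = \<phi> (N+1, a, b) \<and>
      \<phi> (a, 0, b) = \<phi> (a, 1, b) \<and> \<phi> (a, N, b) = \<phi> (a, N+1, b) \<and>
      \<phi> (a, b, 0) = \<phi> (a, b, 1) \<and> \<phi> (a, b, N) = \<phi> (a, b, N+1))"

fun no_penetration :: "nat \<Rightarrow> vfield \<Rightarrow> bool" where
  "no_penetration N (fx, fy, fz) \<longleftrightarrow>
    (\<forall>a\<in>{1..N}. \<forall>b\<in>{1..N}.
      fx (0, a, b) = 0 \<and> fx (N, a, b) = 0 \<and>
      fy (a, 0, b) = 0 \<and> fy (a, N, b) = 0 \<and>
      fz (a, b, 0) = 0 \<and> fz (a, b, N) = 0)"

text \<open>Here \<open>a\<close> is the index in the normal direction, \<open>b\<close> the other tangential index.\<close>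

fun free_slip :: "nat \<Rightarrow> vfield \<Rightarrow> bool" where
  "free_slip N (fx, fy, fz) \<longleftrightarrow>
    (\<forall>a\<in>{0..N}. \<forall>b\<in>{0..N+1}.
      fx (a, 0, b) = fx (a, 1, b) \<and> fx (a, N+1, b) = fx (a, N, b) \<and>
      fx (a, b, 0) = fx (a, b, 1) \<and> fx (a, b, N+1) = fx (a, b, N) \<and>
      fy (0, a, b) = fy (1, a, b) \<and> fy (N+1, a, b) = fy (N, a, b) \<and>
      fy (b, a, 0) = fy (b, a, 1) \<and> fy (b, a, N+1) = fy (b, a, N) \<and>
      fz (0, b, a) = fz (1, b, a) \<and> fz (N+1, b, a) = fz (N, b, a) \<and>
      fz (b, 0, a) = fz (b, 1, a) \<and> fz (b, N+1, a) = fz (b, N, a))"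

fun face_to_cell_dx :: "real \<Rightarrow> grid \<Rightarrow> grid" where
  "face_to_cell_dx h f (i, j, k) = (f (i, j, k) - f (i - 1, j, k)) / h"

fun face_to_cell_dy :: "real \<Rightarrow> grid \<Rightarrow> grid" where
  "face_to_cell_dy h f (i, j, k) = (f (i, j, k) - f (i, j - 1, k)) / h"

fun face_to_cell_dz :: "real \<Rightarrow> grid \<Rightarrow> grid" where
  "face_to_cell_dz h f (i, j, k) = (f (i, j, k) - f (i, j, k - 1)) / h"

fun div_h :: "real \<Rightarrow> vfield \<Rightarrow> grid" where
  "div_h h (fx, fy, fz) =
    (\<lambda>c. face_to_cell_dx h fx c + face_to_cell_dy h fy c + face_to_cell_dz h fz c)"

fun avg_x :: "grid \<Rightarrow> grid" where
  "avg_x \<phi> (i, j, k) = (\<phi> (i + 1, j, k) + \<phi> (i, j, k)) / 2"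

fun avg_y :: "grid \<Rightarrow> grid" where
  "avg_y \<phi> (i, j, k) = (\<phi> (i, j + 1, k) + \<phi> (i, j, k)) / 2"

fun avg_z :: "grid \<Rightarrow> grid" where
  "avg_z \<phi> (i, j, k) = (\<phi> (i, j, k + 1) + \<phi> (i, j, k)) / 2"

definition avg_h :: "grid \<Rightarrow> vfield" where
  "avg_h \<phi> = (avg_x \<phi>, avg_y \<phi>, avg_z \<phi>)"

fun cell_to_face_Dx :: "real \<Rightarrow> grid \<Rightarrow> grid" where
  "cell_to_face_Dx h \<phi> (i, j, k) = (\<phi> (i + 1, j, k) - \<phi> (i, j, k)) / h"

fun cell_to_face_Dy :: "real \<Rightarrow> grid \<Rightarrow> grid" where
  "cell_to_face_Dy h \<phi> (i, j, k) = (\<phi> (i, j + 1, k) - \<phi> (i, j, k)) / h"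

fun cell_to_face_Dz :: "real \<Rightarrow> grid \<Rightarrow> grid" where
  "cell_to_face_Dz h \<phi> (i, j, k) = (\<phi> (i, j, k + 1) - \<phi> (i, j, k)) / h"

definition grad_h :: "real \<Rightarrow> grid \<Rightarrow> vfield" where
  "grad_h h \<phi> = (cell_to_face_Dx h \<phi>, cell_to_face_Dy h \<phi>, cell_to_face_Dz h \<phi>)"

definition cell_laplacian :: "real \<Rightarrow> grid \<Rightarrow> grid" where
  "cell_laplacian h \<phi> = div_h h (grad_h h \<phi>)"

text \<open>The 7-point Laplacian reads the same on the three staggered grids.\<close>

fun face_laplacian :: "real \<Rightarrow> grid \<Rightarrow> grid" where
  "face_laplacian h f (i, j, k) =
    (f (i + 1, j, k) + f (i - 1, j, k) + f (i, j + 1, k) + f (i, j - 1, k)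
      + f (i, j, k + 1) + f (i, j, k - 1) - 6 * f (i, j, k)) / h\<^sup>2"

fun field_times :: "vfield \<Rightarrow> vfield \<Rightarrow> vfield" where
  "field_times (ax, ay, az) (fx, fy, fz) =
    (\<lambda>c. ax c * fx c, \<lambda>c. ay c * fy c, \<lambda>c. az c * fz c)"

definition cell_inner :: "nat \<Rightarrow> real \<Rightarrow> grid \<Rightarrow> grid \<Rightarrow> real" where
  "cell_inner N h \<phi> \<psi> = h ^ 3 * (\<Sum>c\<in>interior_cells N. \<phi> c * \<psi> c)"

definition cell_mean :: "nat \<Rightarrow> real \<Rightarrow> grid \<Rightarrow> real" where
  "cell_mean N L \<phi> = cell_inner N (L / real N) \<phi> (\<lambda>_. 1) / L ^ 3"

definition sup_norm :: "nat \<Rightarrow> grid \<Rightarrow> real" where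
  "sup_norm N \<phi> = Max ((\<lambda>c. \<bar>\<phi> c\<bar>) ` interior_cells N)"

text \<open>One component of the Stokes equation: \<open>u\<close>, \<open>gp\<close>, \<open>F\<close> are the components of the velocity,
  of the pressure gradient and of \<open>A\<^sub>h \<phi>\<^sup>n \<nabla>\<^sub>h \<mu>\<close>; \<open>S\<close> is the set of faces where it is imposed.\<close>

definition stokes_component ::
    "real \<Rightarrow> real \<Rightarrow> (nat \<times> nat \<times> nat) set \<Rightarrow> grid \<Rightarrow> grid \<Rightarrow> grid \<Rightarrow> bool" where
  "stokes_component h \<gamma> S u gp F \<longleftrightarrow>
    (\<forall>c\<in>S. - face_laplacian h u c + u c + gp c + \<gamma> * F c = 0)"

fun stokes_equation :: "nat \<Rightarrow> real \<Rightarrow> real \<Rightarrow> vfield \<Rightarrow> vfield \<Rightarrow> vfield \<Rightarrow> bool" where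
  "stokes_equation N h \<gamma> (ux, uy, uz) (px, py, pz) (Fx, Fy, Fz) \<longleftrightarrow>
    stokes_component h \<gamma> (inner_faces_x N) ux px Fx \<and>
    stokes_component h \<gamma> (inner_faces_y N) uy py Fy \<and>
    stokes_component h \<gamma> (inner_faces_z N) uz pz Fz"

text \<open>\<open>\<phi>n\<close> is the datum at the old time level, \<open>\<phi>\<close>, \<open>\<mu>\<close>, \<open>u\<close>, \<open>p\<close> are the unknowns at the new
  one. The logarithms are meaningful only where \<open>\<bar>\<phi>\<bar> < 1\<close>, which is imposed separately through
  \<open>sup_norm N \<phi> < 1\<close>.\<close>

definition scheme ::
    "nat \<Rightarrow> real \<Rightarrow> real \<Rightarrow> real \<Rightarrow> real \<Rightarrow> real \<Rightarrow> grid \<Rightarrow> grid \<Rightarrow> grid \<Rightarrow> vfield \<Rightarrow> grid \<Rightarrow> bool" where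
  "scheme N h s \<gamma> \<epsilon> \<theta>\<^sub>0 \<phi>n \<phi> \<mu> u p \<longleftrightarrow>
    (\<forall>c\<in>interior_cells N.
      \<phi> c - \<phi>n c = s * cell_laplacian h \<mu> c - s * div_h h (field_times (avg_h \<phi>n) u) c) \<and>
    (\<forall>c\<in>interior_cells N.
      \<mu> c = ln (1 + \<phi> c) - ln (1 - \<phi> c) - \<theta>\<^sub>0 * \<phi>n c - \<epsilon>\<^sup>2 * cell_laplacian h \<phi> c) \<and>
    stokes_equation N h \<gamma> u (grad_h h p) (field_times (avg_h \<phi>n) (grad_h h \<mu>)) \<and>
    (\<forall>c\<in>interior_cells N. div_h h u c = 0)"

end

theory Submission
  imports Defs "HOL-Analysis.Analysis" "HOL-Real_Asymp.Real_Asymp"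
begin

text \<open>
  Existence is variational: with the flux \<open>j\<close> and the velocity \<open>u\<close> as unknowns and
  \<open>\<phi> = \<phi>\<^sup>n - s \<nabla>\<^sub>h \<cdot> (j + A\<^sub>h \<phi>\<^sup>n u)\<close>, minimize
  \<open>s/2 \<parallel>j\<parallel>\<^sup>2 + s/(2\<gamma>) (\<parallel>u\<parallel>\<^sup>2 + \<parallel>\<nabla>\<^sub>h u\<parallel>\<^sup>2) + \<epsilon>\<^sup>2/2 \<parallel>\<nabla>\<^sub>h \<phi>\<parallel>\<^sup>2
  + \<Sum> ((1 + \<phi>) ln (1 + \<phi>) + (1 - \<phi>) ln (1 - \<phi>) - \<theta>\<^sub>0 \<phi>\<^sup>n \<phi>)\<close> over divergence-free \<open>u\<close> with
  \<open>\<bar>\<phi>\<bar> \<le> 1\<close>. The infinite slope of \<open>x ln x\<close> at 0 keeps the minimizer away from \<open>\<bar>\<phi>\<bar> = 1\<close>. Its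
  Euler-Lagrange equations say that \<open>j = - \<nabla>\<^sub>h \<mu>\<close> and that
  \<open>(I - \<Delta>\<^sub>h) u + \<gamma> A\<^sub>h \<phi>\<^sup>n \<nabla>\<^sub>h \<mu>\<close> is orthogonal to all divergence-free fields, hence a pressure
  gradient. Uniqueness is an energy estimate for the difference of two solutions.
\<close>

text \<open>With flux and velocity as unknowns the transport equation becomes the definition of the
  phase. Mass is then conserved by construction, and neither the Neumann Laplacian nor the Stokes
  operator has to be inverted. The term with \<open>\<theta>\<^sub>0 \<phi>\<^sup>n\<close> is
  explicit, hence linear in the energy, and the logarithmic part is convex. Two obstacles shape the
  argument. The constraint is imposed with a non-strict bound, because compactness needs a closed
  set; strictness has to be recovered before the logarithms can be differentiated. Moreover the old
  state is bounded only by M and may leave [-1,1], so zero flux and zero velocity need not be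
  admissible. The substitute is the constant state \<beta>, which some flux reaches because the grid
  is connected. It makes the admissible set nonempty, gives the energy level that confines the
  search to a box, and is the interior target towards which the minimizer is moved. Ghost values are
  kept out of this argument: it runs on functions of interior cells and inner faces, and the
  boundary conditions return only in the translation at the end.\<close>

text \<open>Induction on \<open>I\<close>: a vector in the kernel of the other functionals on which
  \<open>l i\<close> does not vanish fixes the coefficient of \<open>l i\<close>; without such a
  vector the coefficient is 0. Here \<open>comb t x y\<close> plays the role of x - t y, so that the
  lemma serves cell functions and face functions alike. It is the finite-dimensional fact behind
  both the flux that reaches \<beta> and the pressure.\<close>

lemma functional_in_span:
  fixes l :: "'i \<Rightarrow> 'v \<Rightarrow> real" and f :: "'v \<Rightarrow> real"
  assumes "finite I"
    and V: "\<And>t x y. x \<in> V \<Longrightarrow> y \<in> V \<Longrightarrow> comb t x y \<in> V"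
    and l: "\<And>i t x y. x \<in> V \<Longrightarrow> y \<in> V \<Longrightarrow> l i (comb t x y) = l i x - t * l i y"
    and f: "\<And>t x y. x \<in> V \<Longrightarrow> y \<in> V \<Longrightarrow> f (comb t x y) = f x - t * f y"
    and ker: "\<And>x. x \<in> V \<Longrightarrow> (\<And>i. i \<in> I \<Longrightarrow> l i x = 0) \<Longrightarrow> f x = 0"
  shows "\<exists>c. \<forall>x\<in>V. f x = (\<Sum>i\<in>I. c i * l i x)"
  using assms(1) f ker
proof (induction I arbitrary: f rule: finite_induct)
  case empty
  then show ?case by simp
next
  case (insert i I)
  show ?case
  proof (cases "\<exists>y\<in>V. (\<forall>j\<in>I. l j y = 0) \<and> l i y \<noteq> 0")
    case False
    then have "\<And>x. x \<in> V \<Longrightarrow> (\<And>j. j \<in> I \<Longrightarrow> l j x = 0) \<Longrightarrow> f x = 0"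
      using insert.prems(2) by blast
    then obtain c where "\<forall>x\<in>V. f x = (\<Sum>j\<in>I. c j * l j x)"
      using insert.IH[of f] insert.prems(1) by blast
    moreover have "(\<Sum>j\<in>I. (c(i := 0)) j * l j x) = (\<Sum>j\<in>I. c j * l j x)" for x
      using insert.hyps by (intro sum.cong) auto
    ultimately show ?thesis
      using insert.hyps by (intro exI[of _ "c(i := 0)"]) simp
  next
    case True
    then obtain y where y: "y \<in> V" "\<And>j. j \<in> I \<Longrightarrow> l j y = 0" "l i y \<noteq> 0"
      by blast
    \<comment> \<open>The multiple of \<open>l i\<close> is the one that makes \<open>g\<close>
      vanish at \<open>y\<close>.\<close>
    define g where "g x = f x - (f y / l i y) * l i x" for x
    have "g (comb t x z) = g x - t * g z" if "x \<in> V" "z \<in> V" for t x z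
      unfolding g_def insert.prems(1)[OF that] l[OF that] by (simp add: algebra_simps)
    moreover have "g x = 0" if x: "x \<in> V" and lx: "\<And>j. j \<in> I \<Longrightarrow> l j x = 0" for x
    proof -
      \<comment> \<open>Moving \<open>x\<close> along \<open>y\<close> brings it into the kernel of
        \<open>l i\<close> and leaves the other functionals unchanged.\<close>
      let ?z = "comb (l i x / l i y) x y"
      have "f ?z = 0"
      proof (rule insert.prems(2))
        show "?z \<in> V" using V x y(1) by blast
        show "l j ?z = 0" if "j \<in> insert i I" for j
          using that lx y l[OF x y(1)] by auto
      qed
      then show ?thesis
        using insert.prems(1)[OF x y(1)] y(3) by (simp add: g_def)
    qed
    ultimately obtain c where c: "\<forall>x\<in>V. g x = (\<Sum>j\<in>I. c j * l j x)"
      using insert.IH[of g] by blast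
    have "(\<Sum>j\<in>I. (c(i := f y / l i y)) j * l j x) = (\<Sum>j\<in>I. c j * l j x)" for x
      using insert.hyps by (intro sum.cong) auto
    then show ?thesis
      using c insert.hyps
      by (intro exI[of _ "c(i := f y / l i y)"]) (simp add: g_def algebra_simps)
  qed
qed

section \<open>The logarithmic potential and its behaviour at the endpoints\<close>

text \<open>The factor x makes the value at 0 equal to the limit 0, whatever \<open>ln 0\<close> is;
  this gives continuity on the closed half-line.\<close>

definition xlnx :: "real \<Rightarrow> real" where
  "xlnx x = x * ln x"

lemma xlnx_ge: "x \<ge> 0 \<Longrightarrow> xlnx x \<ge> -1"
proof (cases "x = 0")
  case False
  assume "x \<ge> 0"
  with False have x: "x > 0" by simp
  then have "ln (1 / x) \<le> 1 / x - 1" by (intro ln_le_minus_one) simp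
  then have "x * (- ln x) \<le> x * (1 / x - 1)"
    using x by (intro mult_left_mono) (auto simp: ln_div)
  then show ?thesis using x by (simp add: xlnx_def algebra_simps)
qed (simp add: xlnx_def)

text \<open>This is ln r \<le> r - 1 at r = z / y, multiplied by y.\<close>

lemma xlnx_tangent:
  assumes "z > 0" "y \<ge> 0"
  shows "xlnx y \<ge> xlnx z + (ln z + 1) * (y - z)"
proof (cases "y = 0")
  case True
  then show ?thesis using assms by (simp add: xlnx_def algebra_simps)
next
  case False
  with assms have y: "y > 0" by simp
  then have "ln (z / y) \<le> z / y - 1"
    using assms by (intro ln_le_minus_one) simp
  then have "y * (ln z - ln y) \<le> y * (z / y - 1)"
    using y assms by (intro mult_left_mono) (auto simp: ln_div)
  then show ?thesis using y by (simp add: xlnx_def algebra_simps)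
qed

text \<open>The tangent at the intermediate point bounds both endpoint values from below, and in the
  weighted sum the slopes cancel. The point is positive even for y = 0, since b and t are.\<close>

lemma xlnx_convex:
  assumes "y \<ge> 0" "b > 0" "0 < t" "t \<le> 1"
  shows "xlnx (y + t * (b - y)) \<le> xlnx y + t * (xlnx b - xlnx y)"
proof -
  let ?z = "y + t * (b - y)"
  have z: "?z > 0"
  proof -
    have "?z = (1 - t) * y + t * b" by (simp add: algebra_simps)
    moreover have "(1 - t) * y \<ge> 0" "t * b > 0" using assms by auto
    ultimately show ?thesis by linarith
  qed
  have "(1 - t) * xlnx y + t * xlnx b \<ge>
      (1 - t) * (xlnx ?z + (ln ?z + 1) * (y - ?z)) + t * (xlnx ?z + (ln ?z + 1) * (b - ?z))"
    using assms z by (intro add_mono mult_left_mono xlnx_tangent) auto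
  also have "(1 - t) * (xlnx ?z + (ln ?z + 1) * (y - ?z)) + t * (xlnx ?z + (ln ?z + 1) * (b - ?z))
      = xlnx ?z + (ln ?z + 1) * ((1 - t) * (y - ?z) + t * (b - ?z))"
    by (simp add: algebra_simps)
  also have "(1 - t) * (y - ?z) + t * (b - ?z) = 0"
    by (simp add: algebra_simps)
  finally show ?thesis by (simp add: algebra_simps)
qed

lemma continuous_on_xlnx: "continuous_on {0..} xlnx"
proof -
  have "continuous (at x within {0..}) xlnx" if "x \<ge> 0" for x
  proof (cases "x = 0")
    case True
    have "((\<lambda>x::real. x * ln x) \<longlongrightarrow> 0) (at_right 0)"
      by real_asymp
    then have "(xlnx \<longlongrightarrow> xlnx 0) (at 0 within {0..})"
      by (simp add: xlnx_def[abs_def] at_within_Ici_at_right)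
    then show ?thesis
      by (simp add: True continuous_within)
  next
    case False
    then have "isCont xlnx x"
      using that unfolding xlnx_def[abs_def] by (intro continuous_intros) auto
    then show ?thesis
      by (rule continuous_at_imp_continuous_at_within)
  qed
  then show ?thesis
    by (simp add: continuous_on_eq_continuous_within)
qed

lemma has_derivative_xlnx:
  assumes "x > 0"
  shows "(xlnx has_real_derivative ln x + 1) (at x)"
  unfolding xlnx_def[abs_def] using assms by (auto intro!: derivative_eq_intros)

text \<open>The convex part of the Flory-Huggins energy; the two constants 1 in the derivatives of
  \<open>xlnx\<close> cancel, which leaves the logarithmic terms of the scheme.\<close>

definition log_potential :: "real \<Rightarrow> real" where
  "log_potential x = xlnx (1 + x) + xlnx (1 - x)"

lemma log_potential_ge: "\<bar>x\<bar> \<le> 1 \<Longrightarrow> log_potential x \<ge> -2"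
  using xlnx_ge[of "1 + x"] xlnx_ge[of "1 - x"] unfolding log_potential_def by linarith

lemma continuous_on_log_potential: "continuous_on {-1..1} log_potential"
  unfolding log_potential_def
  by (intro continuous_intros continuous_on_compose2[OF continuous_on_xlnx]) auto

lemma has_derivative_log_potential:
  assumes "\<bar>x\<bar> < 1"
  shows "(log_potential has_real_derivative ln (1 + x) - ln (1 - x)) (at x)"
proof -
  have "((\<lambda>x. xlnx (1 + x)) has_real_derivative (ln (1 + x) + 1) * 1) (at x)"
    using assms by (intro DERIV_chain2[OF has_derivative_xlnx])
      (auto intro!: derivative_eq_intros)
  moreover have "((\<lambda>x. xlnx (1 - x)) has_real_derivative (ln (1 - x) + 1) * (-1)) (at x)"
    using assms by (intro DERIV_chain2[OF has_derivative_xlnx])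
      (auto intro!: derivative_eq_intros)
  ultimately have "((\<lambda>x. xlnx (1 + x) + xlnx (1 - x)) has_real_derivative
      (ln (1 + x) + 1) * 1 + (ln (1 - x) + 1) * (-1)) (at x)"
    by (rule DERIV_add)
  then show ?thesis
    by (simp add: log_potential_def[abs_def])
qed

lemma log_potential_convex:
  assumes "\<bar>y\<bar> \<le> 1" "\<bar>b\<bar> < 1" "0 < t" "t \<le> 1"
  shows "log_potential (y + t * (b - y)) \<le> log_potential y + t * (log_potential b - log_potential y)"
proof -
  have "xlnx (1 + y + t * (1 + b - (1 + y))) \<le> xlnx (1 + y) + t * (xlnx (1 + b) - xlnx (1 + y))"
    "xlnx (1 - y + t * (1 - b - (1 - y))) \<le> xlnx (1 - y) + t * (xlnx (1 - b) - xlnx (1 - y))"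
    using assms by (intro xlnx_convex; linarith)+
  then show ?thesis
    by (simp add: log_potential_def algebra_simps)
qed

text \<open>One of the two \<open>xlnx\<close> terms starts from 0, where xlnx (t d) = t xlnx d + t
  d ln t holds exactly with d the distance from y to b; convexity handles the other. Near t = 0 the
  extra term beats every multiple of t.\<close>

lemma log_potential_singular:
  assumes "\<bar>y\<bar> = 1" "\<bar>b\<bar> < 1"
  shows "\<exists>d>0. \<forall>t. 0 < t \<longrightarrow> t \<le> 1 \<longrightarrow>
    log_potential (y + t * (b - y)) \<le> log_potential y + t * (log_potential b - log_potential y)
      + t * d * ln t"
proof (cases "y = 1")
  case True
  have "log_potential (y + t * (b - y)) \<le> log_potential y + t * (log_potential b - log_potential y)
      + t * (1 - b) * ln t" if "0 < t" "t \<le> 1" for t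
  proof -
    have "xlnx (2 + t * (b - 1)) \<le> xlnx 2 + t * (xlnx (1 + b) - xlnx 2)"
      using xlnx_convex[of 2 "1 + b" t] assms that by simp
    moreover have "xlnx (t * (1 - b)) = t * xlnx (1 - b) + t * (1 - b) * ln t"
      unfolding xlnx_def using that assms by (subst ln_mult) (auto simp: ring_distribs mult_ac)
    ultimately show ?thesis
      by (simp add: True log_potential_def algebra_simps) (simp add: xlnx_def)
  qed
  then show ?thesis using assms by (intro exI[of _ "1 - b"]) auto
next
  case False
  then have y: "y = -1" using assms by linarith
  have "log_potential (y + t * (b - y)) \<le> log_potential y + t * (log_potential b - log_potential y)
      + t * (1 + b) * ln t" if "0 < t" "t \<le> 1" for t
  proof -
    have "xlnx (2 + t * (- 1 - b)) \<le> xlnx 2 + t * (xlnx (1 - b) - xlnx 2)"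
      using xlnx_convex[of 2 "1 - b" t] assms that by simp
    moreover have "xlnx (t * (1 + b)) = t * xlnx (1 + b) + t * (1 + b) * ln t"
      unfolding xlnx_def using that assms by (subst ln_mult) (auto simp: ring_distribs mult_ac)
    ultimately show ?thesis
      by (simp add: y log_potential_def algebra_simps) (simp add: xlnx_def)
  qed
  then show ?thesis using assms by (intro exI[of _ "1 + b"]) auto
qed

lemma log_difference_strict_mono:
  fixes x y :: real
  assumes "\<bar>x\<bar> < 1" "\<bar>y\<bar> < 1" "x \<noteq> y"
  shows "((ln (1 + x) - ln (1 - x)) - (ln (1 + y) - ln (1 - y))) * (x - y) > 0"
proof -
  have *: "ln (1 + x) - ln (1 - x) < ln (1 + y) - ln (1 - y)"
    if "\<bar>x\<bar> < 1" "\<bar>y\<bar> < 1" "x < y" for x y :: real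
    using that ln_less_cancel_iff[of "1 + x" "1 + y"] ln_less_cancel_iff[of "1 - y" "1 - x"]
    by linarith
  show ?thesis
    using assms *[of x y] *[of y x] by (cases "x < y") (auto intro: mult_pos_pos mult_neg_neg)
qed

text \<open>Tychonoff for a product of intervals, with the singleton {0} as factor off
  \<open>F\<close>. It applies although the index type of the faces is infinite.\<close>

lemma compact_box_supported:
  fixes F :: "'a set" and R :: real
  shows "compact {w :: 'a \<Rightarrow> real. (\<forall>e\<in>F. \<bar>w e\<bar> \<le> R) \<and> (\<forall>e. e \<notin> F \<longrightarrow> w e = 0)}"
proof -
  have "compact (PiE UNIV (\<lambda>e. if e \<in> F then {-R..R} else {0::real}))"
    unfolding compactin_euclidean_iff[symmetric] euclidean_product_topology[symmetric]
    by (simp add: compactin_PiE)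
  moreover have "{w :: 'a \<Rightarrow> real. (\<forall>e\<in>F. \<bar>w e\<bar> \<le> R) \<and> (\<forall>e. e \<notin> F \<longrightarrow> w e = 0)}
      = PiE UNIV (\<lambda>e. if e \<in> F then {-R..R} else {0::real})"
    by (auto simp: PiE_def Pi_def abs_le_iff split: if_splits)
  ultimately show ?thesis by simp
qed

section \<open>The variational problem on an abstract staggered grid\<close>

text \<open>\<open>dv\<close>, \<open>gr\<close> and \<open>B\<close> stand for the discrete divergence, the discrete gradient and \<open>- \<Delta>\<^sub>h\<close> on
  faces. Vanishing off the set \<open>F\<close> of inner faces encodes the no-penetration condition.\<close>

locale staggered_system =
  fixes C :: "'c set" and F :: "'f set"
    and dv :: "('f \<Rightarrow> real) \<Rightarrow> 'c \<Rightarrow> real"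
    and gr :: "('c \<Rightarrow> real) \<Rightarrow> 'f \<Rightarrow> real"
    and B :: "('f \<Rightarrow> real) \<Rightarrow> 'f \<Rightarrow> real"
  assumes fin_C: "finite C" and fin_F: "finite F" and C_ne: "C \<noteq> {}"
    and dv_lin: "\<And>x y t c. dv (\<lambda>e. x e + t * y e) c = dv x c + t * dv y c"
    and gr_lin: "\<And>p q t e. gr (\<lambda>c. p c + t * q c) e = gr p e + t * gr q e"
    and B_lin: "\<And>x y t e. B (\<lambda>e. x e + t * y e) e = B x e + t * B y e"
    and dv_cont: "\<And>c. continuous_on UNIV (\<lambda>w. dv w c)"
    and gr_cont: "\<And>e. continuous_on UNIV (\<lambda>p. gr p e)"
    and B_cont: "\<And>e. continuous_on UNIV (\<lambda>w. B w e)"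
    and gr_off: "\<And>p e. e \<notin> F \<Longrightarrow> gr p e = 0"
    and adj: "\<And>p w. (\<And>e. e \<notin> F \<Longrightarrow> w e = 0) \<Longrightarrow>
      (\<Sum>e\<in>F. gr p e * w e) = - (\<Sum>c\<in>C. p c * dv w c)"
    and gr_const: "\<And>t e. gr (\<lambda>_. t) e = 0"
    and gr_ker: "\<And>p c c'. (\<And>e. e \<in> F \<Longrightarrow> gr p e = 0) \<Longrightarrow> c \<in> C \<Longrightarrow> c' \<in> C \<Longrightarrow> p c = p c'"
    and B_sym: "\<And>x y. (\<And>e. e \<notin> F \<Longrightarrow> x e = 0) \<Longrightarrow> (\<And>e. e \<notin> F \<Longrightarrow> y e = 0) \<Longrightarrow>
      (\<Sum>e\<in>F. B x e * y e) = (\<Sum>e\<in>F. x e * B y e)"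
    and B_psd: "\<And>x. (\<And>e. e \<notin> F \<Longrightarrow> x e = 0) \<Longrightarrow> (\<Sum>e\<in>F. x e * B x e) \<ge> 0"
begin

definition V :: "('f \<Rightarrow> real) set" where
  "V = {w. \<forall>e. e \<notin> F \<longrightarrow> w e = 0}"

text \<open>Neumann and free-slip conditions do not appear: the former sits in \<open>gr\<close>
  being 0 off \<open>F\<close>, the latter is left to the operator \<open>B\<close>.\<close>

definition solution where
  "solution s \<gamma> \<epsilon> \<theta> a \<phi>n \<phi> \<mu> u p \<longleftrightarrow> u \<in> V \<and>
    (\<forall>c\<in>C. \<phi> c - \<phi>n c = s * dv (gr \<mu>) c - s * dv (\<lambda>e. a e * u e) c) \<and>
    (\<forall>c\<in>C. \<mu> c = ln (1 + \<phi> c) - ln (1 - \<phi> c) - \<theta> * \<phi>n c - \<epsilon>\<^sup>2 * dv (gr \<phi>) c) \<and>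
    (\<forall>e\<in>F. B u e + u e + gr p e + \<gamma> * (a e * gr \<mu> e) = 0) \<and>
    (\<forall>c\<in>C. dv u c = 0)"

lemma adjV: "w \<in> V \<Longrightarrow> (\<Sum>e\<in>F. gr p e * w e) = - (\<Sum>c\<in>C. p c * dv w c)"
  by (rule adj) (simp add: V_def)

lemma gr_V: "gr p \<in> V"
  by (simp add: V_def gr_off)

lemma mult_V: "w \<in> V \<Longrightarrow> (\<lambda>e. a e * w e) \<in> V"
  by (simp add: V_def)

lemma add_V: "x \<in> V \<Longrightarrow> y \<in> V \<Longrightarrow> (\<lambda>e. x e + t * y e) \<in> V"
  by (simp add: V_def)

lemma dv_diff: "dv (\<lambda>e. x e - y e) c = dv x c - dv y c"
  using dv_lin[of x "-1" y c] by simp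

lemma gr_diff: "gr (\<lambda>e. x e - y e) c = gr x c - gr y c"
  using gr_lin[of x "-1" y c] by simp

lemma B_diff: "B (\<lambda>e. x e - y e) c = B x c - B y c"
  using B_lin[of x "-1" y c] by simp

lemma dv_zero: "dv (\<lambda>_. 0) c = 0"
  using dv_lin[of "\<lambda>_. 0" 1 "\<lambda>_. 0" c] by simp

lemma sum_dv: "w \<in> V \<Longrightarrow> (\<Sum>c\<in>C. dv w c) = 0"
  using adjV[of w "\<lambda>_. 1"] by (simp add: gr_const)

text \<open>Pairing with the indicator of one face turns \<open>adj\<close> into a formula for the
  gradient that reads values on \<open>C\<close> only. Values elsewhere may therefore be changed at
  will.\<close>

lemma gr_cong:
  assumes "\<And>c. c \<in> C \<Longrightarrow> p c = q c"
  shows "gr p = gr q"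
proof
  fix e
  show "gr p e = gr q e"
  proof (cases "e \<in> F")
    case True
    let ?\<delta> = "\<lambda>e'. if e' = e then 1 else 0 :: real"
    have \<delta>: "?\<delta> \<in> V" using True by (auto simp: V_def)
    have "(\<Sum>e'\<in>F. gr p e' * ?\<delta> e') = (\<Sum>e'\<in>F. gr q e' * ?\<delta> e')"
      unfolding adjV[OF \<delta>] using assms by simp
    then show ?thesis using True fin_F by (simp add: mult_delta_right)
  qed (simp add: gr_off)
qed

lemma solution_cong:
  assumes "\<And>c. c \<in> C \<Longrightarrow> \<phi> c = \<phi>' c" "\<And>c. c \<in> C \<Longrightarrow> \<mu> c = \<mu>' c" "\<And>c. c \<in> C \<Longrightarrow> p c = p' c"
    and "solution s \<gamma> \<epsilon> \<theta> a \<phi>n \<phi> \<mu> u p"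
  shows "solution s \<gamma> \<epsilon> \<theta> a \<phi>n \<phi>' \<mu>' u p'"
  using assms gr_cong[of \<phi> \<phi>'] gr_cong[of \<mu> \<mu>'] gr_cong[of p p'] by (simp add: solution_def)

text \<open>Both terms on the right of the transport equation are divergences of fields in
  \<open>V\<close>, whose sums vanish by testing with the constant 1.\<close>

lemma solution_mass:
  assumes "solution s \<gamma> \<epsilon> \<theta> a \<phi>n \<phi> \<mu> u p"
  shows "(\<Sum>c\<in>C. \<phi> c - \<phi>n c) = 0"
proof -
  have "(\<Sum>c\<in>C. \<phi> c - \<phi>n c) = (\<Sum>c\<in>C. s * dv (gr \<mu>) c - s * dv (\<lambda>e. a e * u e) c)"
    using assms by (intro sum.cong) (auto simp: solution_def)
  also have "\<dots> = 0"
    using assms sum_dv[OF gr_V] sum_dv[OF mult_V, of u a]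
    by (simp add: sum_subtractf flip: sum_distrib_left) (simp add: solution_def)
  finally show ?thesis .
qed

text \<open>Testing the difference of the transport equations with the difference of the potentials, and
  the difference of the Stokes equations with that of the velocities, bounds \<open>(\<phi>\<^sub>1 - \<phi>\<^sub>2, \<mu>\<^sub>1 - \<mu>\<^sub>2)\<close>
  from above by 0; the monotonicity of the logarithmic terms bounds it from below.\<close>

lemma solution_unique:
  assumes s: "s > 0" and \<gamma>: "\<gamma> > 0"
    and sol1: "solution s \<gamma> \<epsilon> \<theta> a \<phi>n \<phi>1 \<mu>1 u1 p1" and b1: "\<And>c. c \<in> C \<Longrightarrow> \<bar>\<phi>1 c\<bar> < 1"
    and sol2: "solution s \<gamma> \<epsilon> \<theta> a \<phi>n \<phi>2 \<mu>2 u2 p2" and b2: "\<And>c. c \<in> C \<Longrightarrow> \<bar>\<phi>2 c\<bar> < 1"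
    and c: "c \<in> C"
  shows "\<phi>1 c = \<phi>2 c"
proof -
  define d\<phi> where "d\<phi> c = \<phi>1 c - \<phi>2 c" for c
  define d\<mu> where "d\<mu> c = \<mu>1 c - \<mu>2 c" for c
  define dp where "dp c = p1 c - p2 c" for c
  define du where "du e = u1 e - u2 e" for e
  define lg where "lg \<phi> c = ln (1 + \<phi> c) - ln (1 - \<phi> c)" for \<phi> :: "'c \<Rightarrow> real" and c
  have du_V: "du \<in> V"
    using sol1 sol2 by (simp add: V_def du_def solution_def)
  have gr_d: "gr d\<phi> e = gr \<phi>1 e - gr \<phi>2 e" "gr d\<mu> e = gr \<mu>1 e - gr \<mu>2 e"
      "gr dp e = gr p1 e - gr p2 e" "B du e = B u1 e - B u2 e" for e
    unfolding d\<phi>_def[abs_def] d\<mu>_def[abs_def] dp_def[abs_def] du_def[abs_def]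
    by (rule gr_diff B_diff)+
  have dv_d: "dv (gr d\<mu>) c = dv (gr \<mu>1) c - dv (gr \<mu>2) c"
      "dv (gr d\<phi>) c = dv (gr \<phi>1) c - dv (gr \<phi>2) c"
      "dv (\<lambda>e. a e * du e) c = dv (\<lambda>e. a e * u1 e) c - dv (\<lambda>e. a e * u2 e) c"
      "dv du c = dv u1 c - dv u2 c" for c
  proof -
    have *: "gr d\<mu> = (\<lambda>e. gr \<mu>1 e - gr \<mu>2 e)" "gr d\<phi> = (\<lambda>e. gr \<phi>1 e - gr \<phi>2 e)"
      "(\<lambda>e. a e * du e) = (\<lambda>e. a e * u1 e - a e * u2 e)" "du = (\<lambda>e. u1 e - u2 e)"
      by (auto simp: gr_d du_def right_diff_distrib)
    show "dv (gr d\<mu>) c = dv (gr \<mu>1) c - dv (gr \<mu>2) c"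
      unfolding *(1) by (rule dv_diff)
    show "dv (gr d\<phi>) c = dv (gr \<phi>1) c - dv (gr \<phi>2) c"
      unfolding *(2) by (rule dv_diff)
    show "dv (\<lambda>e. a e * du e) c = dv (\<lambda>e. a e * u1 e) c - dv (\<lambda>e. a e * u2 e) c"
      unfolding *(3) by (rule dv_diff)
    show "dv du c = dv u1 c - dv u2 c"
      unfolding *(4) by (rule dv_diff)
  qed
  have transport: "d\<phi> c = s * dv (gr d\<mu>) c - s * dv (\<lambda>e. a e * du e) c" if "c \<in> C" for c
  proof -
    have "\<phi>1 c - \<phi>n c = s * dv (gr \<mu>1) c - s * dv (\<lambda>e. a e * u1 e) c"
      "\<phi>2 c - \<phi>n c = s * dv (gr \<mu>2) c - s * dv (\<lambda>e. a e * u2 e) c"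
      using sol1 sol2 that by (auto simp: solution_def)
    then show ?thesis
      unfolding dv_d d\<phi>_def by (simp add: algebra_simps)
  qed
  \<comment> \<open>The explicit term with \<theta> is common to both solutions and cancels; only
    monotone contributions remain.\<close>
  have potential: "d\<mu> c = (lg \<phi>1 c - lg \<phi>2 c) - \<epsilon>\<^sup>2 * dv (gr d\<phi>) c" if "c \<in> C" for c
  proof -
    have "\<mu>1 c = lg \<phi>1 c - \<theta> * \<phi>n c - \<epsilon>\<^sup>2 * dv (gr \<phi>1) c"
      "\<mu>2 c = lg \<phi>2 c - \<theta> * \<phi>n c - \<epsilon>\<^sup>2 * dv (gr \<phi>2) c"
      using sol1 sol2 that by (auto simp: solution_def lg_def)
    then show ?thesis
      unfolding dv_d d\<mu>_def by (simp add: algebra_simps)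
  qed
  have stokes: "B du e + du e + gr dp e + \<gamma> * (a e * gr d\<mu> e) = 0" if "e \<in> F" for e
  proof -
    have "B u1 e + u1 e + gr p1 e + \<gamma> * (a e * gr \<mu>1 e) = 0"
      "B u2 e + u2 e + gr p2 e + \<gamma> * (a e * gr \<mu>2 e) = 0"
      using sol1 sol2 that by (auto simp: solution_def)
    then show ?thesis
      unfolding gr_d du_def by (simp add: algebra_simps)
  qed
  have div_free: "dv du c = 0" if "c \<in> C" for c
    using sol1 sol2 that by (simp add: dv_d solution_def)
  have "(\<Sum>c\<in>C. d\<mu> c * d\<phi> c)
      = (\<Sum>c\<in>C. s * (d\<mu> c * dv (gr d\<mu>) c) - s * (d\<mu> c * dv (\<lambda>e. a e * du e) c))"
    by (intro sum.cong) (simp_all add: transport algebra_simps)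
  also have "\<dots> = s * (\<Sum>c\<in>C. d\<mu> c * dv (gr d\<mu>) c) - s * (\<Sum>c\<in>C. d\<mu> c * dv (\<lambda>e. a e * du e) c)"
    by (simp add: sum_subtractf sum_distrib_left)
  also have "\<dots> = - s * (\<Sum>e\<in>F. gr d\<mu> e * gr d\<mu> e) + s * (\<Sum>e\<in>F. gr d\<mu> e * (a e * du e))"
    using adjV[OF gr_V, of d\<mu> d\<mu>] adjV[OF mult_V[OF du_V], of d\<mu> a] by simp
  finally have upper: "(\<Sum>c\<in>C. d\<mu> c * d\<phi> c)
      = - s * (\<Sum>e\<in>F. gr d\<mu> e * gr d\<mu> e) + s * (\<Sum>e\<in>F. gr d\<mu> e * (a e * du e))" .
  have "0 = (\<Sum>e\<in>F. (B du e + du e + gr dp e + \<gamma> * (a e * gr d\<mu> e)) * du e)"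
    by (simp add: stokes)
  also have "\<dots> = (\<Sum>e\<in>F. du e * B du e) + (\<Sum>e\<in>F. du e * du e) + (\<Sum>e\<in>F. gr dp e * du e)
      + \<gamma> * (\<Sum>e\<in>F. gr d\<mu> e * (a e * du e))"
    by (simp add: algebra_simps sum.distrib sum_distrib_left)
  also have "(\<Sum>e\<in>F. gr dp e * du e) = 0"
    using adjV[OF du_V, of dp] by (simp add: div_free)
  \<comment> \<open>This is the coupling term of \<open>upper\<close>: up to the factor \<gamma> it
    is minus the viscous dissipation. Hence both contributions to \<open>upper\<close> are
    nonpositive.\<close>
  finally have "\<gamma> * (\<Sum>e\<in>F. gr d\<mu> e * (a e * du e))
      = - ((\<Sum>e\<in>F. du e * B du e) + (\<Sum>e\<in>F. du e * du e))"
    by linarith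
  moreover have "(\<Sum>e\<in>F. du e * B du e) \<ge> 0"
    using du_V by (intro B_psd) (simp add: V_def)
  moreover have "(\<Sum>e\<in>F. du e * du e) \<ge> 0"
    by (intro sum_nonneg) simp
  ultimately have "\<gamma> * (\<Sum>e\<in>F. gr d\<mu> e * (a e * du e)) \<le> 0"
    by linarith
  then have "(\<Sum>e\<in>F. gr d\<mu> e * (a e * du e)) \<le> 0"
    using \<gamma> by (simp add: mult_le_0_iff)
  then have "s * (\<Sum>e\<in>F. gr d\<mu> e * (a e * du e)) \<le> 0"
    using s by (simp add: mult_le_0_iff)
  moreover have "s * (\<Sum>e\<in>F. gr d\<mu> e * gr d\<mu> e) \<ge> 0"
    using s by (simp add: sum_nonneg)
  ultimately have le: "(\<Sum>c\<in>C. d\<mu> c * d\<phi> c) \<le> 0"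
    using upper by linarith
  have "(\<Sum>c\<in>C. d\<mu> c * d\<phi> c)
      = (\<Sum>c\<in>C. (lg \<phi>1 c - lg \<phi>2 c) * d\<phi> c - \<epsilon>\<^sup>2 * (d\<phi> c * dv (gr d\<phi>) c))"
    by (intro sum.cong) (simp_all add: potential algebra_simps)
  also have "\<dots> = (\<Sum>c\<in>C. (lg \<phi>1 c - lg \<phi>2 c) * d\<phi> c) - \<epsilon>\<^sup>2 * (\<Sum>c\<in>C. d\<phi> c * dv (gr d\<phi>) c)"
    by (simp add: sum_subtractf sum_distrib_left)
  also have "\<dots> = (\<Sum>c\<in>C. (lg \<phi>1 c - lg \<phi>2 c) * d\<phi> c) + \<epsilon>\<^sup>2 * (\<Sum>e\<in>F. gr d\<phi> e * gr d\<phi> e)"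
    using adjV[OF gr_V, of d\<phi> d\<phi>] by simp
  finally have lower: "(\<Sum>c\<in>C. d\<mu> c * d\<phi> c)
      = (\<Sum>c\<in>C. (lg \<phi>1 c - lg \<phi>2 c) * d\<phi> c) + \<epsilon>\<^sup>2 * (\<Sum>e\<in>F. gr d\<phi> e * gr d\<phi> e)" .
  have "\<epsilon>\<^sup>2 * (\<Sum>e\<in>F. gr d\<phi> e * gr d\<phi> e) \<ge> 0"
    by (simp add: sum_nonneg)
  with le lower have "(\<Sum>c\<in>C. (lg \<phi>1 c - lg \<phi>2 c) * d\<phi> c) \<le> 0"
    by linarith
  moreover have pos: "(lg \<phi>1 c - lg \<phi>2 c) * d\<phi> c > 0" if "c \<in> C" "\<phi>1 c \<noteq> \<phi>2 c" for c
    using log_difference_strict_mono[OF b1 b2, of c c] that by (simp add: lg_def d\<phi>_def)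
  then have nn: "(lg \<phi>1 c - lg \<phi>2 c) * d\<phi> c \<ge> 0" if "c \<in> C" for c
    using that by (cases "\<phi>1 c = \<phi>2 c") (auto simp: d\<phi>_def intro: less_imp_le)
  \<comment> \<open>A sum of nonnegative terms squeezed to 0 forces each term to be 0, and strict
    monotonicity excludes distinct values.\<close>
  ultimately have "(\<Sum>c\<in>C. (lg \<phi>1 c - lg \<phi>2 c) * d\<phi> c) = 0"
    by (intro antisym sum_nonneg) auto
  then have "(lg \<phi>1 c - lg \<phi>2 c) * d\<phi> c = 0"
    using nn c fin_C by (simp add: sum_nonneg_eq_0_iff)
  then show ?thesis using pos[OF c] by force
qed

end

section \<open>Admissible states and existence of a minimizer\<close>

locale discrete_problem = staggered_system C F dv gr B
  for C :: "'c set" and F :: "'f set" and dv gr B +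
  fixes s \<gamma> \<epsilon> \<theta> \<beta> :: real and a :: "'f \<Rightarrow> real" and \<phi>n :: "'c \<Rightarrow> real"
  assumes s: "s > 0" and \<gamma>: "\<gamma> > 0"
    and mean: "(\<Sum>c\<in>C. \<phi>n c) = \<beta> * real (card C)" and \<beta>: "\<bar>\<beta>\<bar> < 1"
begin

definition phase :: "('f \<Rightarrow> real) \<Rightarrow> ('f \<Rightarrow> real) \<Rightarrow> 'c \<Rightarrow> real" where
  "phase j u = (\<lambda>c. \<phi>n c - s * dv (\<lambda>e. j e + a e * u e) c)"

definition feasible :: "('f \<Rightarrow> real) \<Rightarrow> ('f \<Rightarrow> real) \<Rightarrow> bool" where
  "feasible j u \<longleftrightarrow> j \<in> V \<and> u \<in> V \<and> (\<forall>c\<in>C. dv u c = 0) \<and> (\<forall>c\<in>C. \<bar>phase j u c\<bar> \<le> 1)"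

text \<open>The part of the energy that is polynomial along lines, hence differentiable even where
  the phase touches 1 or -1. The weight s / (2 \<gamma>) is chosen so that varying \<open>u\<close>
  gives the Stokes residual. Plain sums suffice because the cell volume is a common factor.\<close>

definition quad :: "('f \<Rightarrow> real) \<Rightarrow> ('f \<Rightarrow> real) \<Rightarrow> real" where
  "quad j u = s / 2 * (\<Sum>e\<in>F. (j e)\<^sup>2) + s / (2 * \<gamma>) * (\<Sum>e\<in>F. u e * (u e + B u e))
    + \<epsilon>\<^sup>2 / 2 * (\<Sum>e\<in>F. (gr (phase j u) e)\<^sup>2) - \<theta> * (\<Sum>c\<in>C. \<phi>n c * phase j u c)"

definition energy :: "('f \<Rightarrow> real) \<Rightarrow> ('f \<Rightarrow> real) \<Rightarrow> real" where
  "energy j u = quad j u + (\<Sum>c\<in>C. log_potential (phase j u c))"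

text \<open>The linear part of the affine map \<open>phase\<close>.\<close>

definition var :: "('f \<Rightarrow> real) \<Rightarrow> ('f \<Rightarrow> real) \<Rightarrow> 'c \<Rightarrow> real" where
  "var k v = (\<lambda>c. - s * dv (\<lambda>e. k e + a e * v e) c)"

lemma phase_line:
  "phase (\<lambda>e. j e + t * k e) (\<lambda>e. u e + t * v e) = (\<lambda>c. phase j u c + t * var k v c)"
proof
  fix c
  have "dv (\<lambda>e. (j e + t * k e) + a e * (u e + t * v e)) c
      = dv (\<lambda>e. (j e + a e * u e) + t * (k e + a e * v e)) c"
    by (simp add: algebra_simps)
  also have "\<dots> = dv (\<lambda>e. j e + a e * u e) c + t * dv (\<lambda>e. k e + a e * v e) c"
    by (rule dv_lin)
  finally show "phase (\<lambda>e. j e + t * k e) (\<lambda>e. u e + t * v e) c = phase j u c + t * var k v c"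
    by (simp add: phase_def var_def algebra_simps)
qed

text \<open>Subtracting the mean leaves a function orthogonal to constants, that is, to the kernel
  of the gradient. So pairing with it is a combination of the functionals \<open>gr p e\<close>, and
  by \<open>adj\<close> the function is a divergence.\<close>

lemma ex_feasible: "\<exists>j0\<in>V. \<forall>c\<in>C. phase j0 (\<lambda>_. 0) c = \<beta>"
proof -
  have "\<exists>k. \<forall>p\<in>UNIV. (\<Sum>c\<in>C. (\<phi>n c - \<beta>) * p c) = (\<Sum>e\<in>F. k e * gr p e)"
  proof (rule functional_in_span[OF fin_F, where comb = "\<lambda>t x y c. x c - t * y c"])
    show "gr (\<lambda>c. x c - t * y c) e = gr x e - t * gr y e" for e t x y
      using gr_lin[of x "- t" y e] by simp
    show "(\<Sum>c\<in>C. (\<phi>n c - \<beta>) * (x c - t * y c))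
        = (\<Sum>c\<in>C. (\<phi>n c - \<beta>) * x c) - t * (\<Sum>c\<in>C. (\<phi>n c - \<beta>) * y c)" for t x y
      by (simp add: right_diff_distrib sum_subtractf sum_distrib_left mult.left_commute)
    show "(\<Sum>c\<in>C. (\<phi>n c - \<beta>) * p c) = 0" if "\<And>e. e \<in> F \<Longrightarrow> gr p e = 0" for p
    proof -
      obtain c0 where "c0 \<in> C" using C_ne by blast
      then have "(\<Sum>c\<in>C. (\<phi>n c - \<beta>) * p c) = (\<Sum>c\<in>C. (\<phi>n c - \<beta>) * p c0)"
        by (intro sum.cong refl) (metis gr_ker that)
      also have "\<dots> = ((\<Sum>c\<in>C. \<phi>n c) - \<beta> * real (card C)) * p c0"
        by (simp add: sum_subtractf flip: sum_distrib_right)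
      finally show ?thesis by (simp add: mean)
    qed
  qed auto
  then obtain k where k: "\<And>p. (\<Sum>c\<in>C. (\<phi>n c - \<beta>) * p c) = (\<Sum>e\<in>F. k e * gr p e)"
    by auto
  \<comment> \<open>The sign and the division by \<open>s\<close> undo those in \<open>phase\<close>
    and \<open>adj\<close>; cutting off outside \<open>F\<close> gives membership in
    \<open>V\<close>.\<close>
  define j where "j e = (if e \<in> F then - k e / s else 0)" for e
  have j: "j \<in> V" by (simp add: j_def V_def)
  have "phase j (\<lambda>_. 0) c = \<beta>" if c: "c \<in> C" for c
  proof -
    let ?\<delta> = "\<lambda>c'. if c' = c then 1 else 0 :: real"
    have "\<phi>n c - \<beta> = (\<Sum>c'\<in>C. (\<phi>n c' - \<beta>) * ?\<delta> c')"
      using c fin_C by (simp add: mult_delta_right)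
    also have "\<dots> = (\<Sum>e\<in>F. k e * gr ?\<delta> e)" by (rule k)
    also have "\<dots> = (\<Sum>e\<in>F. - s * (gr ?\<delta> e * j e))"
      using s by (intro sum.cong) (auto simp: j_def)
    also have "\<dots> = - s * (\<Sum>e\<in>F. gr ?\<delta> e * j e)"
      by (simp only: sum_distrib_left)
    also have "\<dots> = s * (\<Sum>c'\<in>C. ?\<delta> c' * dv j c')"
      by (simp add: adjV[OF j])
    also have "\<dots> = s * dv j c"
      using c fin_C by (simp add: mult_delta_left)
    finally show ?thesis by (simp add: phase_def)
  qed
  with j show ?thesis by blast
qed

text \<open>Coercivity: \<open>B\<close> and the gradient term contribute nonnegatively, the bound
  on the phase controls the linear term, and each logarithmic term is at least -2.\<close>

lemma energy_lower_bound:
  assumes "feasible j u"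
  shows "energy j u \<ge> s / 2 * (\<Sum>e\<in>F. (j e)\<^sup>2) + s / (2 * \<gamma>) * (\<Sum>e\<in>F. (u e)\<^sup>2)
    - (\<bar>\<theta>\<bar> * (\<Sum>c\<in>C. \<bar>\<phi>n c\<bar>) + 2 * real (card C))"
proof -
  have "(\<Sum>e\<in>F. u e * (u e + B u e)) = (\<Sum>e\<in>F. (u e)\<^sup>2) + (\<Sum>e\<in>F. u e * B u e)"
    by (simp add: algebra_simps power2_eq_square sum.distrib)
  moreover have "(\<Sum>e\<in>F. u e * B u e) \<ge> 0"
    using assms by (intro B_psd) (auto simp: feasible_def V_def)
  ultimately have "s / (2 * \<gamma>) * (\<Sum>e\<in>F. u e * (u e + B u e)) \<ge> s / (2 * \<gamma>) * (\<Sum>e\<in>F. (u e)\<^sup>2)"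
    using s \<gamma> by (intro mult_left_mono) auto
  moreover have "\<epsilon>\<^sup>2 / 2 * (\<Sum>e\<in>F. (gr (phase j u) e)\<^sup>2) \<ge> 0"
    by (intro mult_nonneg_nonneg sum_nonneg) auto
  moreover have "\<theta> * (\<Sum>c\<in>C. \<phi>n c * phase j u c) \<le> \<bar>\<theta>\<bar> * (\<Sum>c\<in>C. \<bar>\<phi>n c\<bar>)"
  proof -
    have "\<bar>\<Sum>c\<in>C. \<phi>n c * phase j u c\<bar> \<le> (\<Sum>c\<in>C. \<bar>\<phi>n c\<bar> * 1)"
      using assms by (intro order.trans[OF sum_abs] sum_mono)
        (auto simp: abs_mult feasible_def intro!: mult_left_le)
    then have "\<bar>\<theta>\<bar> * \<bar>\<Sum>c\<in>C. \<phi>n c * phase j u c\<bar> \<le> \<bar>\<theta>\<bar> * (\<Sum>c\<in>C. \<bar>\<phi>n c\<bar>)"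
      by (intro mult_left_mono) auto
    then show ?thesis
      by (simp add: abs_le_iff flip: abs_mult)
  qed
  moreover have "(\<Sum>c\<in>C. log_potential (phase j u c)) \<ge> (\<Sum>c\<in>C. - 2)"
    using assms by (intro sum_mono log_potential_ge) (auto simp: feasible_def)
  ultimately show ?thesis
    by (simp add: energy_def quad_def)
qed

lemma continuous_phase:
  "continuous_on UNIV (\<lambda>x. phase (fst x) (snd x) c)"
proof -
  have "continuous_on UNIV (\<lambda>x e. fst x e + a e * snd x e)"
    by (intro continuous_on_coordinatewise_then_product continuous_intros
        continuous_on_product_then_coordinatewise[OF continuous_on_fst]
        continuous_on_product_then_coordinatewise[OF continuous_on_snd])
  then have "continuous_on UNIV (\<lambda>x. dv (\<lambda>e. fst x e + a e * snd x e) c)"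
    by (rule continuous_on_compose2[OF dv_cont]) auto
  then show ?thesis
    unfolding phase_def by (intro continuous_intros)
qed

lemma continuous_quad: "continuous_on UNIV (\<lambda>x. quad (fst x) (snd x))"
proof -
  have coord: "continuous_on UNIV (\<lambda>x :: ('f \<Rightarrow> real) \<times> ('f \<Rightarrow> real). fst x e)"
    "continuous_on UNIV (\<lambda>x :: ('f \<Rightarrow> real) \<times> ('f \<Rightarrow> real). snd x e)" for e
    by (rule continuous_on_product_then_coordinatewise[OF continuous_on_fst[OF continuous_on_id]]
        continuous_on_product_then_coordinatewise[OF continuous_on_snd[OF continuous_on_id]])+
  have "continuous_on UNIV (\<lambda>x. B (snd x) e)" for e
    by (rule continuous_on_compose2[OF B_cont continuous_on_snd]) (auto intro: continuous_intros)
  moreover have "continuous_on UNIV (\<lambda>x. phase (fst x) (snd x))"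
    by (intro continuous_on_coordinatewise_then_product continuous_phase)
  then have "continuous_on UNIV (\<lambda>x. gr (phase (fst x) (snd x)) e)" for e
    by (rule continuous_on_compose2[OF gr_cont]) auto
  ultimately show ?thesis
    unfolding quad_def by (intro continuous_intros coord continuous_phase)
qed

text \<open>Outside a large box the energy exceeds that of the reference state \<beta>, so the
  minimum over the compact admissible part of the box is global.\<close>

lemma ex_minimizer:
  "\<exists>j u. feasible j u \<and> (\<forall>j' u'. feasible j' u' \<longrightarrow> energy j u \<le> energy j' u')"
proof -
  obtain j0 where j0: "j0 \<in> V" "\<forall>c\<in>C. phase j0 (\<lambda>_. 0) c = \<beta>"
    using ex_feasible by blast
  have feas0: "feasible j0 (\<lambda>_. 0)"
    using j0 \<beta> by (auto simp: feasible_def V_def dv_zero)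
  \<comment> \<open>Once the quadratic part exceeds \<open>K\<close>, the lower bound for the energy
    exceeds the reference level.\<close>
  define K where "K = \<bar>energy j0 (\<lambda>_. 0)\<bar> + \<bar>\<theta>\<bar> * (\<Sum>c\<in>C. \<bar>\<phi>n c\<bar>) + 2 * real (card C)"
  define m where "m = min (s / 2) (s / (2 * \<gamma>))"
  \<comment> \<open>Beyond 1 a square dominates the absolute value, and beyond K / m the latter
    times \<open>m\<close> exceeds \<open>K\<close>; a single large coordinate is then
    enough.\<close>
  define R where "R = max 1 (K / m)"
  have m: "m > 0" using s \<gamma> by (simp add: m_def)
  have K: "K \<ge> 0" by (simp add: K_def sum_nonneg)
  have mR: "m * x\<^sup>2 > K" if "\<bar>x\<bar> > R" for x
  proof -
    have "K \<le> m * R" using m by (simp add: R_def field_simps max_def split: if_splits)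
    also have "\<dots> < m * \<bar>x\<bar>" using m that by simp
    also have "\<dots> \<le> m * \<bar>x\<bar>\<^sup>2"
      using m that by (intro mult_left_mono self_le_power) (auto simp: R_def)
    finally show ?thesis by simp
  qed
  have large: "energy j u > energy j0 (\<lambda>_. 0)"
    if feas: "feasible j u" and e: "e \<in> F" "\<bar>j e\<bar> > R \<or> \<bar>u e\<bar> > R" for j u e
  proof -
    have "K < m * (\<Sum>e\<in>F. (j e)\<^sup>2) + m * (\<Sum>e\<in>F. (u e)\<^sup>2)"
    proof -
      have "(\<Sum>e\<in>F. (j e)\<^sup>2) \<ge> (j e)\<^sup>2" "(\<Sum>e\<in>F. (u e)\<^sup>2) \<ge> (u e)\<^sup>2"
        using e(1) fin_F by (auto intro!: member_le_sum)
      then have "m * (\<Sum>e\<in>F. (j e)\<^sup>2) \<ge> m * (j e)\<^sup>2" "m * (\<Sum>e\<in>F. (u e)\<^sup>2) \<ge> m * (u e)\<^sup>2"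
        using m by auto
      moreover have "m * (j e)\<^sup>2 \<ge> 0" "m * (u e)\<^sup>2 \<ge> 0" using m by auto
      ultimately show ?thesis using e(2) mR[of "j e"] mR[of "u e"] by linarith
    qed
    also have "\<dots> \<le> s / 2 * (\<Sum>e\<in>F. (j e)\<^sup>2) + s / (2 * \<gamma>) * (\<Sum>e\<in>F. (u e)\<^sup>2)"
      by (intro add_mono mult_right_mono sum_nonneg) (auto simp: m_def)
    finally show ?thesis
      using energy_lower_bound[OF feas] by (simp add: K_def)
  qed
  define Box where "Box = {w :: 'f \<Rightarrow> real. (\<forall>e\<in>F. \<bar>w e\<bar> \<le> R) \<and> (\<forall>e. e \<notin> F \<longrightarrow> w e = 0)}"
  define S where "S = (Box \<times> Box) \<inter>
    (\<Inter>c\<in>C. {x. dv (snd x) c = 0} \<inter> {x. \<bar>phase (fst x) (snd x) c\<bar> \<le> 1})"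
  have S_iff: "(j, u) \<in> S \<longleftrightarrow> feasible j u \<and> (\<forall>e\<in>F. \<bar>j e\<bar> \<le> R \<and> \<bar>u e\<bar> \<le> R)" for j u
    by (auto simp: S_def Box_def feasible_def V_def)
  have "closed ({x. dv (snd x) c = 0} \<inter> {x. \<bar>phase (fst x) (snd x) c\<bar> \<le> 1})" for c
  proof (intro closed_Int closed_Collect_eq closed_Collect_le)
    show "continuous_on UNIV (\<lambda>x :: ('f \<Rightarrow> real) \<times> ('f \<Rightarrow> real). dv (snd x) c)"
      by (rule continuous_on_compose2[OF dv_cont continuous_on_snd]) (auto intro: continuous_intros)
  qed (intro continuous_intros continuous_phase)+
  then have "compact S"
    unfolding S_def Box_def
    by (intro compact_Int_closed compact_Times compact_box_supported closed_INT ballI)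
  moreover have "(j0, \<lambda>_. 0) \<in> S"
    using feas0 large[OF feas0] by (force simp: S_iff not_less)
  \<comment> \<open>Continuity is claimed on \<open>S\<close> only: there the phase stays in [-1,1],
    where \<open>log_potential\<close> is known to be continuous.\<close>
  moreover have "continuous_on S (\<lambda>x. energy (fst x) (snd x))"
    unfolding energy_def
  proof (intro continuous_on_add continuous_on_sum)
    show "continuous_on S (\<lambda>x. quad (fst x) (snd x))"
      by (rule continuous_on_subset[OF continuous_quad]) simp
    show "continuous_on S (\<lambda>x. log_potential (phase (fst x) (snd x) c))" if "c \<in> C" for c
      by (rule continuous_on_compose2[OF continuous_on_log_potential
            continuous_on_subset[OF continuous_phase]])
        (use that in \<open>auto simp: S_def abs_le_iff\<close>)
  qed
  ultimately obtain x where x: "x \<in> S" "\<forall>y\<in>S. energy (fst x) (snd x) \<le> energy (fst y) (snd y)"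
    using continuous_attains_inf[of S "\<lambda>x. energy (fst x) (snd x)"] by blast
  show ?thesis
  proof (intro exI conjI allI impI)
    show "feasible (fst x) (snd x)"
      using x(1) S_iff[of "fst x" "snd x"] by simp
    show "energy (fst x) (snd x) \<le> energy j u" if feas: "feasible j u" for j u
    proof (cases "(j, u) \<in> S")
      case True
      then show ?thesis using x(2) by force
    next
      case False
      then have "energy j u > energy j0 (\<lambda>_. 0)"
        using feas large[OF feas] by (force simp: S_iff not_le)
      moreover have "energy (fst x) (snd x) \<le> energy j0 (\<lambda>_. 0)"
        using x(2) \<open>(j0, \<lambda>_. 0) \<in> S\<close> by force
      ultimately show ?thesis by linarith
    qed
  qed
qed

section \<open>First variation, strict bounds and Euler-Lagrange equations\<close>

text \<open>Since \<open>phase\<close> is affine, \<open>quad\<close> is a quadratic polynomial in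
  t; the symmetry of \<open>B\<close> merges its two cross terms.\<close>

lemma quad_line_derivative:
  assumes u: "u \<in> V" and v: "v \<in> V"
  shows "((\<lambda>t. quad (\<lambda>e. j e + t * k e) (\<lambda>e. u e + t * v e)) has_real_derivative
    s * (\<Sum>e\<in>F. j e * k e) + s / \<gamma> * (\<Sum>e\<in>F. (u e + B u e) * v e)
    + \<epsilon>\<^sup>2 * (\<Sum>e\<in>F. gr (phase j u) e * gr (var k v) e)
    - \<theta> * (\<Sum>c\<in>C. \<phi>n c * var k v c)) (at 0)"
proof -
  have "((\<lambda>t. \<Sum>e\<in>F. (j e + t * k e)\<^sup>2) has_real_derivative (\<Sum>e\<in>F. 2 * (j e * k e))) (at 0)"
    by (auto intro!: derivative_eq_intros sum.cong)
  moreover have "((\<lambda>t. \<Sum>e\<in>F. (gr (phase j u) e + t * gr (var k v) e)\<^sup>2) has_real_derivative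
      (\<Sum>e\<in>F. 2 * (gr (phase j u) e * gr (var k v) e))) (at 0)"
    by (auto intro!: derivative_eq_intros sum.cong)
  moreover have "((\<lambda>t. \<Sum>c\<in>C. \<phi>n c * (phase j u c + t * var k v c)) has_real_derivative
      (\<Sum>c\<in>C. \<phi>n c * var k v c)) (at 0)"
    by (auto intro!: derivative_eq_intros sum.cong)
  moreover have "((\<lambda>t. \<Sum>e\<in>F. (u e + t * v e) * ((u e + t * v e) + (B u e + t * B v e)))
      has_real_derivative (\<Sum>e\<in>F. 2 * ((u e + B u e) * v e))) (at 0)"
  proof -
    have "((\<lambda>t. \<Sum>e\<in>F. (u e + t * v e) * ((u e + t * v e) + (B u e + t * B v e)))
        has_real_derivative (\<Sum>e\<in>F. v e * (u e + B u e) + (v e + B v e) * u e)) (at 0)"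
      by (auto intro!: derivative_eq_intros sum.cong)
    also have "(\<Sum>e\<in>F. v e * (u e + B u e) + (v e + B v e) * u e)
        = (\<Sum>e\<in>F. 2 * (u e * v e)) + (\<Sum>e\<in>F. B u e * v e) + (\<Sum>e\<in>F. u e * B v e)"
      by (simp add: algebra_simps flip: sum.distrib)
    also have "(\<Sum>e\<in>F. u e * B v e) = (\<Sum>e\<in>F. B u e * v e)"
      using B_sym[of u v] u v by (simp add: V_def)
    also have "(\<Sum>e\<in>F. 2 * (u e * v e)) + (\<Sum>e\<in>F. B u e * v e) + (\<Sum>e\<in>F. B u e * v e)
        = (\<Sum>e\<in>F. 2 * ((u e + B u e) * v e))"
      by (simp add: algebra_simps flip: sum.distrib)
    finally show ?thesis .
  qed
  ultimately have "((\<lambda>t. s / 2 * (\<Sum>e\<in>F. (j e + t * k e)\<^sup>2)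
      + s / (2 * \<gamma>) * (\<Sum>e\<in>F. (u e + t * v e) * ((u e + t * v e) + (B u e + t * B v e)))
      + \<epsilon>\<^sup>2 / 2 * (\<Sum>e\<in>F. (gr (phase j u) e + t * gr (var k v) e)\<^sup>2)
      - \<theta> * (\<Sum>c\<in>C. \<phi>n c * (phase j u c + t * var k v c))) has_real_derivative
      s / 2 * (\<Sum>e\<in>F. 2 * (j e * k e))
      + s / (2 * \<gamma>) * (\<Sum>e\<in>F. 2 * ((u e + B u e) * v e))
      + \<epsilon>\<^sup>2 / 2 * (\<Sum>e\<in>F. 2 * (gr (phase j u) e * gr (var k v) e))
      - \<theta> * (\<Sum>c\<in>C. \<phi>n c * var k v c)) (at 0)"
    by (intro DERIV_add DERIV_diff DERIV_cmult)
  moreover have "quad (\<lambda>e. j e + t * k e) (\<lambda>e. u e + t * v e) = s / 2 * (\<Sum>e\<in>F. (j e + t * k e)\<^sup>2)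
      + s / (2 * \<gamma>) * (\<Sum>e\<in>F. (u e + t * v e) * ((u e + t * v e) + (B u e + t * B v e)))
      + \<epsilon>\<^sup>2 / 2 * (\<Sum>e\<in>F. (gr (phase j u) e + t * gr (var k v) e)\<^sup>2)
      - \<theta> * (\<Sum>c\<in>C. \<phi>n c * (phase j u c + t * var k v c))" for t
    unfolding quad_def phase_line gr_lin B_lin by simp
  ultimately show ?thesis
    by (simp flip: sum_distrib_left)
qed

definition minimizer :: "('f \<Rightarrow> real) \<Rightarrow> ('f \<Rightarrow> real) \<Rightarrow> bool" where
  "minimizer j u \<longleftrightarrow> feasible j u \<and> (\<forall>j' u'. feasible j' u' \<longrightarrow> energy j u \<le> energy j' u')"

lemma feasible_line:
  assumes "feasible j u" "k \<in> V" "v \<in> V" "\<And>c. c \<in> C \<Longrightarrow> dv v c = 0"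
    and "\<And>c. c \<in> C \<Longrightarrow> \<bar>phase j u c + t * var k v c\<bar> \<le> 1"
  shows "feasible (\<lambda>e. j e + t * k e) (\<lambda>e. u e + t * v e)"
  using assms by (auto simp: feasible_def phase_line dv_lin add_V)

text \<open>Moving from the minimizer towards the constant state \<open>\<beta>\<close>, the energy changes by at most
  \<open>K t + d t ln t\<close> with some \<open>d > 0\<close> as soon as the minimizer touches \<open>\<plusminus>1\<close>.\<close>

lemma minimizer_interior:
  assumes min: "minimizer j u" and c: "c \<in> C"
  shows "\<bar>phase j u c\<bar> < 1"
proof (rule ccontr)
  assume "\<not> \<bar>phase j u c\<bar> < 1"
  have feas: "feasible j u" using min by (simp add: minimizer_def)
  then have le1: "\<bar>phase j u c\<bar> \<le> 1" if "c \<in> C" for c using that by (simp add: feasible_def)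
  then have c1: "\<bar>phase j u c\<bar> = 1"
    using c \<open>\<not> \<bar>phase j u c\<bar> < 1\<close> by force
  obtain j0 where j0: "j0 \<in> V" "\<forall>c\<in>C. phase j0 (\<lambda>_. 0) c = \<beta>"
    using ex_feasible by blast
  \<comment> \<open>At t = 1 this direction reaches the pair (j0, 0), whose phase is
    \<beta>.\<close>
  define k where "k e = j0 e - j e" for e
  define v where "v e = - u e" for e
  have kv: "k \<in> V" "v \<in> V" using feas j0 by (auto simp: V_def k_def v_def feasible_def)
  have divv: "dv v c = 0" if "c \<in> C" for c
    using feas that dv_diff[of "\<lambda>_. 0" u c] by (simp add: v_def[abs_def] feasible_def dv_zero)
  have var: "var k v c = \<beta> - phase j u c" if "c \<in> C" for c
  proof -
    have "phase (\<lambda>e. j e + 1 * k e) (\<lambda>e. u e + 1 * v e) c = phase j u c + 1 * var k v c"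
      unfolding phase_line ..
    moreover have "(\<lambda>e. j e + 1 * k e) = j0" "(\<lambda>e. u e + 1 * v e) = (\<lambda>_. 0)"
      by (auto simp: k_def v_def)
    ultimately show ?thesis using j0 that by simp
  qed
  define P where "P c = phase j u c" for c
  obtain D where D: "((\<lambda>t. quad (\<lambda>e. j e + t * k e) (\<lambda>e. u e + t * v e)) has_real_derivative D) (at 0)"
    using quad_line_derivative[OF _ kv(2), of u j k] feas by (auto simp: feasible_def)
  define f where "f t = quad (\<lambda>e. j e + t * k e) (\<lambda>e. u e + t * v e)" for t
  have f0: "f 0 = quad j u" by (simp add: f_def)
  obtain d where d: "d > 0" "\<And>t. 0 < t \<Longrightarrow> t \<le> 1 \<Longrightarrow>
      log_potential (P c + t * (\<beta> - P c))
        \<le> log_potential (P c) + t * (log_potential \<beta> - log_potential (P c)) + t * d * ln t"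
    using log_potential_singular[OF c1 \<beta>] unfolding P_def by blast
  define K where "K = (\<Sum>c\<in>C. log_potential \<beta> - log_potential (P c))"
  have "((\<lambda>t. (f (0 + t) - f 0) / t) \<longlongrightarrow> D) (at 0)"
    using D unfolding f_def[symmetric] DERIV_def .
  then have "((\<lambda>t. (f (0 + t) - f 0) / t) \<longlongrightarrow> D) (at_right 0)"
    by (rule filterlim_mono) (auto simp: at_le)
  then have "eventually (\<lambda>t. (f (0 + t) - f 0) / t < D + 1) (at_right 0)"
    by (rule order_tendstoD) simp
  \<comment> \<open>For small t the energy changes by less than t (D + 1 + K + d ln t); this
    threshold makes the bracket negative and contradicts minimality.\<close>
  moreover have "eventually (\<lambda>t::real. ln t < - (D + 1 + K) / d) (at_right 0)"
    using ln_at_0 by (simp add: filterlim_at_bot_dense)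
  moreover have "eventually (\<lambda>t::real. t \<in> {0<..<1}) (at_right 0)"
    by (rule eventually_at_right_real) simp
  ultimately have "eventually (\<lambda>t. (f (0 + t) - f 0) / t < D + 1 \<and> ln t < - (D + 1 + K) / d
      \<and> t \<in> {0<..<1}) (at_right 0)"
    by eventually_elim auto
  then obtain t where t: "(f t - f 0) / t < D + 1" "ln t < - (D + 1 + K) / d" "0 < t" "t < 1"
    using eventually_happens'[OF trivial_limit_at_right_real] by force
  have "feasible (\<lambda>e. j e + t * k e) (\<lambda>e. u e + t * v e)"
  proof (rule feasible_line[OF feas kv divv])
    show "\<bar>phase j u c + t * var k v c\<bar> \<le> 1" if "c \<in> C" for c
    proof -
      have "phase j u c + t * var k v c = (1 - t) * phase j u c + t * \<beta>"
        using that by (simp add: var algebra_simps)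
      moreover have "\<bar>(1 - t) * phase j u c + t * \<beta>\<bar> \<le> (1 - t) * 1 + t * 1"
        using le1[OF that] \<beta> t by (intro order.trans[OF abs_triangle_ineq] add_mono)
          (auto simp: abs_mult intro!: mult_left_le)
      ultimately show ?thesis by simp
    qed
  qed
  then have "energy j u \<le> energy (\<lambda>e. j e + t * k e) (\<lambda>e. u e + t * v e)"
    using min by (simp add: minimizer_def)
  also have "\<dots> = f t + (\<Sum>c\<in>C. log_potential (P c + t * (\<beta> - P c)))"
    by (auto simp: energy_def f_def phase_line var P_def intro!: sum.cong)
  \<comment> \<open>The singular estimate is used at the one cell \<open>c\<close>; plain convexity
    suffices at all others, which may touch the bound too.\<close>
  also have "(\<Sum>c\<in>C. log_potential (P c + t * (\<beta> - P c)))
      \<le> (\<Sum>c'\<in>C. log_potential (P c') + t * (log_potential \<beta> - log_potential (P c'))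
          + (if c' = c then t * d * ln t else 0))"
    using d(2)[of t] t log_potential_convex[OF le1 \<beta>, of _ t]
    by (intro sum_mono) (auto simp: P_def)
  also have "\<dots> = (\<Sum>c\<in>C. log_potential (P c)) + t * K + t * d * ln t"
    using c fin_C by (simp add: sum.distrib K_def sum_distrib_left)
  finally have "quad j u \<le> f t + t * K + t * d * ln t"
    by (simp add: energy_def P_def)
  moreover have "f t - quad j u < t * (D + 1)"
    using t by (simp add: f0 field_simps)
  ultimately have "0 < t * (D + 1) + t * K + t * (d * ln t)"
    by (simp add: mult.assoc)
  then have "0 < t * (D + 1 + K + d * ln t)"
    by (simp add: algebra_simps)
  then have "D + 1 + K + d * ln t > 0"
    using t by (simp add: zero_less_mult_iff)
  moreover have "d * ln t < - (D + 1 + K)"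
    using t(2) d(1) by (simp add: field_simps)
  ultimately show False by linarith
qed

definition potential :: "('f \<Rightarrow> real) \<Rightarrow> ('f \<Rightarrow> real) \<Rightarrow> 'c \<Rightarrow> real" where
  "potential j u = (\<lambda>c. ln (1 + phase j u c) - ln (1 - phase j u c) - \<theta> * \<phi>n c
    - \<epsilon>\<^sup>2 * dv (gr (phase j u)) c)"

text \<open>A first use of \<open>adj\<close> collects all terms in \<open>var\<close> into the
  pairing with the chemical potential. As \<open>var\<close> is itself a divergence, a second use
  moves the gradient onto that potential, where it acts on both \<open>k\<close> and
  \<open>a v\<close>.\<close>

lemma energy_line_derivative:
  assumes u: "u \<in> V" and v: "v \<in> V" and k: "k \<in> V" and int: "\<And>c. c \<in> C \<Longrightarrow> \<bar>phase j u c\<bar> < 1"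
  shows "((\<lambda>t. energy (\<lambda>e. j e + t * k e) (\<lambda>e. u e + t * v e)) has_real_derivative
    s * (\<Sum>e\<in>F. (j e + gr (potential j u) e) * k e)
    + s / \<gamma> * (\<Sum>e\<in>F. (B u e + u e + \<gamma> * (a e * gr (potential j u) e)) * v e)) (at 0)"
proof -
  define \<mu> where "\<mu> = potential j u"
  have "((\<lambda>t. log_potential (phase j u c + t * var k v c)) has_real_derivative
      (ln (1 + phase j u c) - ln (1 - phase j u c)) * var k v c) (at 0)" if "c \<in> C" for c
  proof (rule DERIV_chain2[where f = log_potential])
    show "(log_potential has_real_derivative ln (1 + phase j u c) - ln (1 - phase j u c))
        (at (phase j u c + 0 * var k v c))"
      using has_derivative_log_potential[OF int[OF that]] by simp
    show "((\<lambda>t. phase j u c + t * var k v c) has_real_derivative var k v c) (at 0)"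
      by (auto intro!: derivative_eq_intros)
  qed
  then have "((\<lambda>t. energy (\<lambda>e. j e + t * k e) (\<lambda>e. u e + t * v e)) has_real_derivative
      (s * (\<Sum>e\<in>F. j e * k e) + s / \<gamma> * (\<Sum>e\<in>F. (u e + B u e) * v e)
      + \<epsilon>\<^sup>2 * (\<Sum>e\<in>F. gr (phase j u) e * gr (var k v) e) - \<theta> * (\<Sum>c\<in>C. \<phi>n c * var k v c))
      + (\<Sum>c\<in>C. (ln (1 + phase j u c) - ln (1 - phase j u c)) * var k v c)) (at 0)"
    unfolding energy_def phase_line
    by (intro DERIV_add quad_line_derivative[OF u v] DERIV_sum)
  also have "(\<Sum>e\<in>F. gr (phase j u) e * gr (var k v) e) = (\<Sum>e\<in>F. gr (var k v) e * gr (phase j u) e)"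
    by (simp add: mult.commute)
  also have "\<dots> = - (\<Sum>c\<in>C. var k v c * dv (gr (phase j u)) c)"
    by (rule adjV[OF gr_V])
  also have "(s * (\<Sum>e\<in>F. j e * k e) + s / \<gamma> * (\<Sum>e\<in>F. (u e + B u e) * v e)
      + \<epsilon>\<^sup>2 * - (\<Sum>c\<in>C. var k v c * dv (gr (phase j u)) c) - \<theta> * (\<Sum>c\<in>C. \<phi>n c * var k v c))
      + (\<Sum>c\<in>C. (ln (1 + phase j u c) - ln (1 - phase j u c)) * var k v c)
    = s * (\<Sum>e\<in>F. j e * k e) + s / \<gamma> * (\<Sum>e\<in>F. (u e + B u e) * v e) + (\<Sum>c\<in>C. \<mu> c * var k v c)"
    by (simp add: \<mu>_def potential_def left_diff_distrib right_diff_distrib sum_subtractf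
        sum_distrib_left mult_ac)
  also have "(\<Sum>c\<in>C. \<mu> c * var k v c) = - s * (\<Sum>c\<in>C. \<mu> c * dv (\<lambda>e. k e + a e * v e) c)"
    by (simp add: var_def sum_distrib_left mult_ac sum_negf)
  also have "\<dots> = s * (\<Sum>e\<in>F. gr \<mu> e * (k e + a e * v e))"
  proof -
    have "(\<lambda>e. k e + a e * v e) \<in> V" using k v by (simp add: V_def)
    from adjV[OF this, of \<mu>] show ?thesis by simp
  qed
  also have "s * (\<Sum>e\<in>F. j e * k e) + s / \<gamma> * (\<Sum>e\<in>F. (u e + B u e) * v e)
      + s * (\<Sum>e\<in>F. gr \<mu> e * (k e + a e * v e))
    = s * (\<Sum>e\<in>F. (j e + gr \<mu> e) * k e)
      + s / \<gamma> * (\<Sum>e\<in>F. (B u e + u e + \<gamma> * (a e * gr \<mu> e)) * v e)"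
  proof -
    have "(\<Sum>e\<in>F. gr \<mu> e * (k e + a e * v e))
        = (\<Sum>e\<in>F. gr \<mu> e * k e) + (\<Sum>e\<in>F. a e * gr \<mu> e * v e)"
      by (simp add: sum.distrib algebra_simps)
    moreover have "(\<Sum>e\<in>F. (j e + gr \<mu> e) * k e) = (\<Sum>e\<in>F. j e * k e) + (\<Sum>e\<in>F. gr \<mu> e * k e)"
      by (simp add: sum.distrib algebra_simps)
    moreover have "(\<Sum>e\<in>F. (B u e + u e + \<gamma> * (a e * gr \<mu> e)) * v e)
        = (\<Sum>e\<in>F. (u e + B u e) * v e) + \<gamma> * (\<Sum>e\<in>F. a e * gr \<mu> e * v e)"
      by (simp add: sum.distrib sum_distrib_left algebra_simps)
    ultimately show ?thesis
      using \<gamma> by (simp add: algebra_simps)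
  qed
  finally show ?thesis unfolding \<mu>_def .
qed

text \<open>The strict bounds leave room for small variations of either sign, uniformly over the
  finitely many cells, so the derivative at 0 vanishes.\<close>

lemma euler_lagrange:
  assumes min: "minimizer j u" and k: "k \<in> V" and v: "v \<in> V" and divv: "\<And>c. c \<in> C \<Longrightarrow> dv v c = 0"
  shows "s * (\<Sum>e\<in>F. (j e + gr (potential j u) e) * k e)
    + s / \<gamma> * (\<Sum>e\<in>F. (B u e + u e + \<gamma> * (a e * gr (potential j u) e)) * v e) = 0"
proof -
  have feas: "feasible j u" using min by (simp add: minimizer_def)
  then have u: "u \<in> V" by (simp add: feasible_def)
  have "eventually (\<lambda>t. \<forall>c\<in>C. \<bar>phase j u c + t * var k v c\<bar> < 1) (nhds 0)"
  proof (rule eventually_ball_finite[OF fin_C], rule ballI)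
    fix c assume c: "c \<in> C"
    have "((\<lambda>t. \<bar>phase j u c + t * var k v c\<bar>) \<longlongrightarrow> \<bar>phase j u c + 0 * var k v c\<bar>) (nhds 0)"
      by (intro tendsto_intros filterlim_ident)
    then show "eventually (\<lambda>t. \<bar>phase j u c + t * var k v c\<bar> < 1) (nhds 0)"
      by (rule order_tendstoD) (simp add: minimizer_interior[OF min c])
  qed
  then obtain d where d: "d > 0" "\<And>t c. \<bar>t\<bar> < d \<Longrightarrow> c \<in> C \<Longrightarrow> \<bar>phase j u c + t * var k v c\<bar> < 1"
    unfolding eventually_nhds_metric by (auto simp: dist_real_def)
  show ?thesis
  proof (rule DERIV_local_min[OF energy_line_derivative[OF u v k minimizer_interior[OF min]] d(1)])
    show "\<forall>t. \<bar>0 - t\<bar> < d \<longrightarrow> energy (\<lambda>e. j e + 0 * k e) (\<lambda>e. u e + 0 * v e)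
        \<le> energy (\<lambda>e. j e + t * k e) (\<lambda>e. u e + t * v e)"
    proof (intro allI impI)
      fix t :: real assume t: "\<bar>0 - t\<bar> < d"
      have "feasible (\<lambda>e. j e + t * k e) (\<lambda>e. u e + t * v e)"
        using d(2)[of t] t by (intro feasible_line[OF feas k v divv]) (auto intro: less_imp_le)
      then show "energy (\<lambda>e. j e + 0 * k e) (\<lambda>e. u e + 0 * v e)
        \<le> energy (\<lambda>e. j e + t * k e) (\<lambda>e. u e + t * v e)"
        using min by (simp add: minimizer_def)
    qed
  qed
qed

text \<open>Discrete de Rham: \<open>r\<close> kills the common kernel of the functionals
  \<open>dv _ c\<close>, so it is a combination of them. The coefficients are the pressure, and
  \<open>adj\<close> turns the combination into minus a gradient.\<close>

lemma orthogonal_div_free_is_gradient: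
  assumes "\<And>v. v \<in> V \<Longrightarrow> (\<And>c. c \<in> C \<Longrightarrow> dv v c = 0) \<Longrightarrow> (\<Sum>e\<in>F. r e * v e) = 0"
  shows "\<exists>p. \<forall>e\<in>F. r e + gr p e = 0"
proof -
  have "\<exists>p. \<forall>v\<in>V. (\<Sum>e\<in>F. r e * v e) = (\<Sum>c\<in>C. p c * dv v c)"
  proof (rule functional_in_span[OF fin_C, where comb = "\<lambda>t x y e. x e - t * y e"])
    show "(\<lambda>e. x e - t * y e) \<in> V" if "x \<in> V" "y \<in> V" for t x y
      using that by (simp add: V_def)
    show "dv (\<lambda>e. x e - t * y e) c = dv x c - t * dv y c" for c t x y
      using dv_lin[of x "- t" y c] by simp
    show "(\<Sum>e\<in>F. r e * (x e - t * y e)) = (\<Sum>e\<in>F. r e * x e) - t * (\<Sum>e\<in>F. r e * y e)" for t x y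
      by (simp add: right_diff_distrib sum_subtractf sum_distrib_left mult.left_commute)
  qed (use assms in blast)
  then obtain p where p: "\<And>v. v \<in> V \<Longrightarrow> (\<Sum>e\<in>F. r e * v e) = (\<Sum>c\<in>C. p c * dv v c)"
    by blast
  have "r e + gr p e = 0" if e: "e \<in> F" for e
  proof -
    let ?\<delta> = "\<lambda>e'. if e' = e then 1 else 0 :: real"
    have \<delta>: "?\<delta> \<in> V" using e by (auto simp: V_def)
    have "(\<Sum>e'\<in>F. r e' * ?\<delta> e') = - (\<Sum>e'\<in>F. gr p e' * ?\<delta> e')"
      using p[OF \<delta>] adjV[OF \<delta>, of p] by simp
    then show ?thesis using e fin_F by (simp add: mult_delta_right)
  qed
  then show ?thesis by blast
qed

theorem ex_solution:
  "\<exists>\<phi> \<mu> u p. solution s \<gamma> \<epsilon> \<theta> a \<phi>n \<phi> \<mu> u p \<and> (\<forall>c\<in>C. \<bar>\<phi> c\<bar> < 1)"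
proof -
  obtain j u where min: "minimizer j u"
    using ex_minimizer by (auto simp: minimizer_def)
  define \<phi> where "\<phi> = phase j u"
  define \<mu> where "\<mu> = potential j u"
  have V: "j \<in> V" "u \<in> V" and divu: "\<And>c. c \<in> C \<Longrightarrow> dv u c = 0"
    using min by (auto simp: minimizer_def feasible_def)
  have zero_V: "(\<lambda>_. 0) \<in> V" by (simp add: V_def)
  have "j e + gr \<mu> e = 0" for e
  proof (cases "e \<in> F")
    case True
    let ?\<delta> = "\<lambda>e'. if e' = e then 1 else 0 :: real"
    have "?\<delta> \<in> V" using True by (auto simp: V_def)
    \<comment> \<open>The flux is subject to no divergence constraint, so it can be varied at a
      single face.\<close>
    from euler_lagrange[OF min this zero_V dv_zero] show ?thesis
      using s True fin_F by (simp add: mult_delta_right \<mu>_def)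
  next
    case False
    then show ?thesis using V(1) gr_V[of \<mu>] by (simp add: V_def)
  qed
  then have j: "j = (\<lambda>e. - gr \<mu> e)" by (auto simp: eq_neg_iff_add_eq_0)
  \<comment> \<open>Velocity variations must stay divergence-free; the residual is thus known only
    up to a gradient, and the pressure enters as multiplier.\<close>
  have "\<exists>p. \<forall>e\<in>F. (B u e + u e + \<gamma> * (a e * gr \<mu> e)) + gr p e = 0"
  proof (rule orthogonal_div_free_is_gradient)
    fix v assume "v \<in> V" "\<And>c. c \<in> C \<Longrightarrow> dv v c = 0"
    from euler_lagrange[OF min zero_V this]
    show "(\<Sum>e\<in>F. (B u e + u e + \<gamma> * (a e * gr \<mu> e)) * v e) = 0"
      using s \<gamma> by (simp add: \<mu>_def)
  qed
  then obtain p where p: "\<And>e. e \<in> F \<Longrightarrow> (B u e + u e + \<gamma> * (a e * gr \<mu> e)) + gr p e = 0"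
    by blast
  have "\<phi> c - \<phi>n c = s * dv (gr \<mu>) c - s * dv (\<lambda>e. a e * u e) c" for c
  proof -
    have "dv (\<lambda>e. j e + a e * u e) c = dv (\<lambda>e. a e * u e - gr \<mu> e) c"
      by (simp add: j)
    also have "\<dots> = dv (\<lambda>e. a e * u e) c - dv (gr \<mu>) c"
      by (rule dv_diff)
    finally show ?thesis by (simp add: \<phi>_def phase_def right_diff_distrib)
  qed
  then have "solution s \<gamma> \<epsilon> \<theta> a \<phi>n \<phi> \<mu> u p"
    using V divu p by (simp add: solution_def \<mu>_def \<phi>_def potential_def add_ac)
  moreover have "\<bar>\<phi> c\<bar> < 1" if "c \<in> C" for c
    using minimizer_interior[OF min that] by (simp add: \<phi>_def)
  ultimately show ?thesis by blast
qed

end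

section \<open>The marker-and-cell grid\<close>

text \<open>Tagging index triples by an axis merges the three face grids into one index type, so
  that a velocity field becomes one scalar function, as the abstract system requires.\<close>

datatype axis = X_axis | Y_axis | Z_axis

fun inner_faces :: "nat \<Rightarrow> axis \<Rightarrow> (nat \<times> nat \<times> nat) set" where
  "inner_faces N X_axis = inner_faces_x N"
| "inner_faces N Y_axis = inner_faces_y N"
| "inner_faces N Z_axis = inner_faces_z N"

definition faces :: "nat \<Rightarrow> (axis \<times> nat \<times> nat \<times> nat) set" where
  "faces N = {(d, c). c \<in> inner_faces N d}"

fun component :: "axis \<Rightarrow> vfield \<Rightarrow> grid" where
  "component X_axis (fx, fy, fz) = fx"
| "component Y_axis (fx, fy, fz) = fy"
| "component Z_axis (fx, fy, fz) = fz"

definition fields :: "(axis \<times> nat \<times> nat \<times> nat \<Rightarrow> real) \<Rightarrow> vfield" where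
  "fields w = (\<lambda>c. w (X_axis, c), \<lambda>c. w (Y_axis, c), \<lambda>c. w (Z_axis, c))"

definition face_div :: "real \<Rightarrow> (axis \<times> nat \<times> nat \<times> nat \<Rightarrow> real) \<Rightarrow> grid" where
  "face_div h w = div_h h (fields w)"

text \<open>The value 0 on boundary faces is the Neumann condition.\<close>

definition face_grad :: "nat \<Rightarrow> real \<Rightarrow> grid \<Rightarrow> axis \<times> nat \<times> nat \<times> nat \<Rightarrow> real" where
  "face_grad N h p e = (if e \<in> faces N then component (fst e) (grad_h h p) (snd e) else 0)"

text \<open>With a single ghost layer, reflection at the boundary is projection to the nearest
  interior index.\<close>

definition clamp_index :: "nat \<Rightarrow> nat \<Rightarrow> nat" where
  "clamp_index N i = max 1 (min N i)"

text \<open>Ghost values are filled in by reflection in the tangential directions only; in the normal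
  direction the boundary values of a function supported on the inner faces vanish already.\<close>

definition extend :: "nat \<Rightarrow> (axis \<times> nat \<times> nat \<times> nat \<Rightarrow> real) \<Rightarrow> vfield" where
  "extend N w =
    (\<lambda>(i, j, k). w (X_axis, i, clamp_index N j, clamp_index N k),
     \<lambda>(i, j, k). w (Y_axis, clamp_index N i, j, clamp_index N k),
     \<lambda>(i, j, k). w (Z_axis, clamp_index N i, clamp_index N j, k))"

text \<open>Extending first builds the free-slip condition into the operator; the sign makes it
  positive semidefinite.\<close>

definition face_diffusion ::
    "nat \<Rightarrow> real \<Rightarrow> (axis \<times> nat \<times> nat \<times> nat \<Rightarrow> real) \<Rightarrow> axis \<times> nat \<times> nat \<times> nat \<Rightarrow> real" where
  "face_diffusion N h w e = - face_laplacian h (component (fst e) (extend N w)) (snd e)"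

lemma clamp_index_id: "1 \<le> i \<Longrightarrow> i \<le> N \<Longrightarrow> clamp_index N i = i"
  by (simp add: clamp_index_def)

lemma clamp_index_range: "N > 0 \<Longrightarrow> clamp_index N i \<in> {1..N}"
  by (simp add: clamp_index_def)

lemma clamp_index_boundary:
  assumes "N > 0"
  shows "clamp_index N 0 = 1" "clamp_index N (Suc 0) = 1"
    "clamp_index N N = N" "clamp_index N (Suc N) = N"
  using assms by (auto simp: clamp_index_def)

lemma in_faces_iff:
  "(X_axis, i, j, k) \<in> faces N \<longleftrightarrow> 1 \<le> i \<and> i < N \<and> j \<in> {1..N} \<and> k \<in> {1..N}"
  "(Y_axis, i, j, k) \<in> faces N \<longleftrightarrow> 1 \<le> j \<and> j < N \<and> i \<in> {1..N} \<and> k \<in> {1..N}"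
  "(Z_axis, i, j, k) \<in> faces N \<longleftrightarrow> 1 \<le> k \<and> k < N \<and> i \<in> {1..N} \<and> j \<in> {1..N}"
  by (auto simp: faces_def inner_faces_x_def inner_faces_y_def inner_faces_z_def)

lemma finite_inner_faces: "finite (inner_faces N d)"
  by (cases d) (simp_all add: inner_faces_x_def inner_faces_y_def inner_faces_z_def)

lemma faces_Sigma: "faces N = (SIGMA d:{X_axis, Y_axis, Z_axis}. inner_faces N d)"
  by (auto simp: faces_def) (metis axis.exhaust)

lemma finite_faces: "finite (faces N)"
  by (simp add: faces_Sigma finite_inner_faces)

lemma sum_faces:
  "(\<Sum>e\<in>faces N. g e) = (\<Sum>c\<in>inner_faces_x N. g (X_axis, c)) + (\<Sum>c\<in>inner_faces_y N. g (Y_axis, c))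
    + (\<Sum>c\<in>inner_faces_z N. g (Z_axis, c))"
  for g :: "_ \<Rightarrow> real"
proof -
  have "(\<Sum>e\<in>faces N. g e) = (\<Sum>d\<in>{X_axis, Y_axis, Z_axis}. \<Sum>c\<in>inner_faces N d. g (d, c))"
    unfolding faces_Sigma by (subst sum.Sigma) (auto simp: finite_inner_faces)
  then show ?thesis by simp
qed

section \<open>Summation by parts on the grid\<close>

lemma sum_box:
  "(\<Sum>c\<in>A \<times> B \<times> C. g c) = (\<Sum>i\<in>A. \<Sum>j\<in>B. \<Sum>k\<in>C. g (i, j, k))"
  by (simp add: sum.cartesian_product split_def)

text \<open>With the x index innermost, one-dimensional summation by parts applies on each grid
  line.\<close>

lemma sum_box_x:
  "(\<Sum>c\<in>A \<times> B \<times> C. g c) = (\<Sum>j\<in>B. \<Sum>k\<in>C. \<Sum>i\<in>A. g (i, j, k))"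
proof -
  have "(\<Sum>c\<in>A \<times> B \<times> C. g c) = (\<Sum>j\<in>B. \<Sum>i\<in>A. \<Sum>k\<in>C. g (i, j, k))"
    unfolding sum_box by (rule sum.swap)
  also have "\<dots> = (\<Sum>j\<in>B. \<Sum>k\<in>C. \<Sum>i\<in>A. g (i, j, k))"
    by (intro sum.cong refl) (rule sum.swap)
  finally show ?thesis .
qed

lemma sum_box_y:
  "(\<Sum>c\<in>A \<times> B \<times> C. g c) = (\<Sum>i\<in>A. \<Sum>k\<in>C. \<Sum>j\<in>B. g (i, j, k))"
  unfolding sum_box by (intro sum.cong refl) (rule sum.swap)

lemma sum_second_difference:
  fixes f g :: "nat \<Rightarrow> real"
  shows "(\<Sum>i=1..n. (2 * f i - f (i - 1) - f (i + 1)) * g i)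
    = (\<Sum>i=0..n. (f (i + 1) - f i) * (g (i + 1) - g i))
      + (f 1 - f 0) * g 0 - (f (n + 1) - f n) * g (n + 1)"
  by (induction n) (simp_all add: algebra_simps)

text \<open>The first alternative is met in the normal direction (no penetration), the second in the
  tangential ones (free slip).\<close>

lemma sum_second_difference_bc:
  fixes f g :: "nat \<Rightarrow> real"
  assumes "g 0 = 0 \<and> g (n + 1) = 0 \<or> f 0 = f 1 \<and> f (n + 1) = f n"
  shows "(\<Sum>i=1..n. (2 * f i - f (i - 1) - f (i + 1)) * g i)
    = (\<Sum>i=0..n. (f (i + 1) - f i) * (g (i + 1) - g i))"
  unfolding sum_second_difference using assms by auto

lemma sum_difference_by_parts:
  fixes p w :: "nat \<Rightarrow> real"
  assumes "N > 0" "w 0 = 0" "w N = 0"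
  shows "(\<Sum>i=1..<N. (p (i + 1) - p i) * w i) = - (\<Sum>i=1..N. p i * (w i - w (i - 1)))"
proof -
  \<comment> \<open>The identity with boundary terms, for N = n + 1; both of these vanish with
    \<open>w\<close>.\<close>
  have "(\<Sum>i=1..<Suc n. (p (i + 1) - p i) * w i) + (\<Sum>i=1..Suc n. p i * (w i - w (i - 1)))
      = p (Suc n) * w (Suc n) - p 1 * w 0" for n
    by (induction n) (simp_all add: algebra_simps)
  from this[of "N - 1"] show ?thesis using assms by simp
qed

text \<open>The discrete Dirichlet integral without its 1/h^2. Three separate sizes are kept because
  an inner-face grid has only N - 1 layers in its normal direction.\<close>

definition dirichlet_form :: "nat \<Rightarrow> nat \<Rightarrow> nat \<Rightarrow> grid \<Rightarrow> grid \<Rightarrow> real" where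
  "dirichlet_form n m l f g =
    (\<Sum>j=1..m. \<Sum>k=1..l. \<Sum>i=0..n. (f (i + 1, j, k) - f (i, j, k)) * (g (i + 1, j, k) - g (i, j, k)))
    + (\<Sum>i=1..n. \<Sum>k=1..l. \<Sum>j=0..m. (f (i, j + 1, k) - f (i, j, k)) * (g (i, j + 1, k) - g (i, j, k)))
    + (\<Sum>i=1..n. \<Sum>j=1..m. \<Sum>k=0..l. (f (i, j, k + 1) - f (i, j, k)) * (g (i, j, k + 1) - g (i, j, k)))"

lemma dirichlet_form_commute: "dirichlet_form n m l f g = dirichlet_form n m l g f"
  by (simp add: dirichlet_form_def mult.commute)

lemma dirichlet_form_nonneg: "dirichlet_form n m l f f \<ge> 0"
  unfolding dirichlet_form_def by (intro add_nonneg_nonneg sum_nonneg) simp_all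

lemma sum_face_laplacian:
  assumes x: "\<And>j k. j \<in> {1..m} \<Longrightarrow> k \<in> {1..l} \<Longrightarrow> g (0, j, k) = 0 \<and> g (n + 1, j, k) = 0
      \<or> f (0, j, k) = f (1, j, k) \<and> f (n + 1, j, k) = f (n, j, k)"
    and y: "\<And>i k. i \<in> {1..n} \<Longrightarrow> k \<in> {1..l} \<Longrightarrow> g (i, 0, k) = 0 \<and> g (i, m + 1, k) = 0
      \<or> f (i, 0, k) = f (i, 1, k) \<and> f (i, m + 1, k) = f (i, m, k)"
    and z: "\<And>i j. i \<in> {1..n} \<Longrightarrow> j \<in> {1..m} \<Longrightarrow> g (i, j, 0) = 0 \<and> g (i, j, l + 1) = 0
      \<or> f (i, j, 0) = f (i, j, 1) \<and> f (i, j, l + 1) = f (i, j, l)"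
  shows "(\<Sum>c\<in>{1..n} \<times> {1..m} \<times> {1..l}. - face_laplacian h f c * g c) = dirichlet_form n m l f g / h\<^sup>2"
proof -
  let ?box = "{1..n} \<times> {1..m} \<times> {1..l}"
  let ?x = "\<lambda>(i, j, k). (2 * f (i, j, k) - f (i - 1, j, k) - f (i + 1, j, k)) * g (i, j, k)"
  let ?y = "\<lambda>(i, j, k). (2 * f (i, j, k) - f (i, j - 1, k) - f (i, j + 1, k)) * g (i, j, k)"
  let ?z = "\<lambda>(i, j, k). (2 * f (i, j, k) - f (i, j, k - 1) - f (i, j, k + 1)) * g (i, j, k)"
  have "- face_laplacian h f c * g c = (?x c + ?y c + ?z c) / h\<^sup>2" for c
    by (cases c) (simp add: algebra_simps add_divide_distrib diff_divide_distrib)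
  then have "(\<Sum>c\<in>?box. - face_laplacian h f c * g c)
      = ((\<Sum>c\<in>?box. ?x c) + (\<Sum>c\<in>?box. ?y c) + (\<Sum>c\<in>?box. ?z c)) / h\<^sup>2"
    by (simp only: sum.distrib flip: sum_divide_distrib)
  moreover have "(\<Sum>c\<in>?box. ?x c) = (\<Sum>j=1..m. \<Sum>k=1..l. \<Sum>i=0..n.
      (f (i + 1, j, k) - f (i, j, k)) * (g (i + 1, j, k) - g (i, j, k)))"
    unfolding sum_box_x prod.case
    by (intro sum.cong refl sum_second_difference_bc[of "\<lambda>i. g (i, _, _)" _ "\<lambda>i. f (i, _, _)"] x)
  moreover have "(\<Sum>c\<in>?box. ?y c) = (\<Sum>i=1..n. \<Sum>k=1..l. \<Sum>j=0..m.
      (f (i, j + 1, k) - f (i, j, k)) * (g (i, j + 1, k) - g (i, j, k)))"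
    unfolding sum_box_y prod.case
    by (intro sum.cong refl sum_second_difference_bc[of "\<lambda>j. g (_, j, _)" _ "\<lambda>j. f (_, j, _)"] y)
  moreover have "(\<Sum>c\<in>?box. ?z c) = (\<Sum>i=1..n. \<Sum>j=1..m. \<Sum>k=0..l.
      (f (i, j, k + 1) - f (i, j, k)) * (g (i, j, k + 1) - g (i, j, k)))"
    unfolding sum_box prod.case
    by (intro sum.cong refl sum_second_difference_bc[of "\<lambda>k. g (_, _, k)" _ "\<lambda>k. f (_, _, k)"] z)
  ultimately show ?thesis
    by (simp add: dirichlet_form_def)
qed

lemma inner_faces_box:
  assumes "N > 0"
  shows "inner_faces_x N = {1..N - 1} \<times> {1..N} \<times> {1..N}"
    "inner_faces_y N = {1..N} \<times> {1..N - 1} \<times> {1..N}"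
    "inner_faces_z N = {1..N} \<times> {1..N} \<times> {1..N - 1}"
  using assms by (auto simp: inner_faces_x_def inner_faces_y_def inner_faces_z_def)

text \<open>In the normal direction the extension of \<open>y\<close> vanishes at both ends, in the
  tangential ones that of \<open>x\<close> is reflected. The symmetric form on the right yields both
  symmetry and semidefiniteness.\<close>

lemma sum_face_diffusion:
  assumes N: "N > 0" and y: "\<And>e. e \<notin> faces N \<Longrightarrow> y e = 0"
  shows "(\<Sum>e\<in>faces N. face_diffusion N h x e * y e) =
    dirichlet_form (N - 1) N N (component X_axis (extend N x)) (component X_axis (extend N y)) / h\<^sup>2
    + dirichlet_form N (N - 1) N (component Y_axis (extend N x)) (component Y_axis (extend N y)) / h\<^sup>2
    + dirichlet_form N N (N - 1) (component Z_axis (extend N x)) (component Z_axis (extend N y)) / h\<^sup>2"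
proof -
  note ghost = clamp_index_boundary[OF N]
  have y0: "y (X_axis, 0, j, k) = 0" "y (X_axis, N, j, k) = 0" "y (Y_axis, j, 0, k) = 0"
    "y (Y_axis, j, N, k) = 0" "y (Z_axis, j, k, 0) = 0" "y (Z_axis, j, k, N) = 0" for j k
    by (rule y, simp add: in_faces_iff)+
  have "(\<Sum>c\<in>inner_faces_x N. face_diffusion N h x (X_axis, c) * y (X_axis, c))
      = (\<Sum>c\<in>inner_faces_x N. - face_laplacian h (component X_axis (extend N x)) c
          * component X_axis (extend N y) c)"
    by (intro sum.cong refl)
      (auto simp: face_diffusion_def extend_def inner_faces_x_def clamp_index_id simp del: face_laplacian.simps)
  also have "\<dots> = dirichlet_form (N - 1) N N (component X_axis (extend N x))
      (component X_axis (extend N y)) / h\<^sup>2"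
    unfolding inner_faces_box[OF N] using N
    by (intro sum_face_laplacian) (simp_all add: extend_def y0 ghost)
  finally have 1: "(\<Sum>c\<in>inner_faces_x N. face_diffusion N h x (X_axis, c) * y (X_axis, c)) = \<dots>" .
  have "(\<Sum>c\<in>inner_faces_y N. face_diffusion N h x (Y_axis, c) * y (Y_axis, c))
      = (\<Sum>c\<in>inner_faces_y N. - face_laplacian h (component Y_axis (extend N x)) c
          * component Y_axis (extend N y) c)"
    by (intro sum.cong refl)
      (auto simp: face_diffusion_def extend_def inner_faces_y_def clamp_index_id simp del: face_laplacian.simps)
  also have "\<dots> = dirichlet_form N (N - 1) N (component Y_axis (extend N x))
      (component Y_axis (extend N y)) / h\<^sup>2"
    unfolding inner_faces_box[OF N] using N
    by (intro sum_face_laplacian) (simp_all add: extend_def y0 ghost)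
  finally have 2: "(\<Sum>c\<in>inner_faces_y N. face_diffusion N h x (Y_axis, c) * y (Y_axis, c)) = \<dots>" .
  have "(\<Sum>c\<in>inner_faces_z N. face_diffusion N h x (Z_axis, c) * y (Z_axis, c))
      = (\<Sum>c\<in>inner_faces_z N. - face_laplacian h (component Z_axis (extend N x)) c
          * component Z_axis (extend N y) c)"
    by (intro sum.cong refl)
      (auto simp: face_diffusion_def extend_def inner_faces_z_def clamp_index_id simp del: face_laplacian.simps)
  also have "\<dots> = dirichlet_form N N (N - 1) (component Z_axis (extend N x))
      (component Z_axis (extend N y)) / h\<^sup>2"
    unfolding inner_faces_box[OF N] using N
    by (intro sum_face_laplacian) (simp_all add: extend_def y0 ghost)
  finally have 3: "(\<Sum>c\<in>inner_faces_z N. face_diffusion N h x (Z_axis, c) * y (Z_axis, c)) = \<dots>" .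
  show ?thesis unfolding sum_faces 1 2 3 ..
qed

text \<open>Summation by parts on every grid line. The divergence in a cell next to the boundary
  reads boundary faces, where \<open>w\<close> is 0.\<close>

lemma sum_face_grad:
  assumes N: "N > 0" and w: "\<And>e. e \<notin> faces N \<Longrightarrow> w e = 0"
  shows "(\<Sum>e\<in>faces N. face_grad N h p e * w e) = - (\<Sum>c\<in>interior_cells N. p c * face_div h w c)"
proof -
  let ?I = "interior_cells N"
  have w0: "w (X_axis, 0, j, k) = 0" "w (X_axis, N, j, k) = 0" "w (Y_axis, j, 0, k) = 0"
    "w (Y_axis, j, N, k) = 0" "w (Z_axis, j, k, 0) = 0" "w (Z_axis, j, k, N) = 0" for j k
    by (rule w, simp add: in_faces_iff)+
  let ?x = "\<lambda>(i, j, k). p (i, j, k) * (w (X_axis, i, j, k) - w (X_axis, i - 1, j, k))"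
  let ?y = "\<lambda>(i, j, k). p (i, j, k) * (w (Y_axis, i, j, k) - w (Y_axis, i, j - 1, k))"
  let ?z = "\<lambda>(i, j, k). p (i, j, k) * (w (Z_axis, i, j, k) - w (Z_axis, i, j, k - 1))"
  have "(\<Sum>c\<in>inner_faces_x N. face_grad N h p (X_axis, c) * w (X_axis, c))
      = (\<Sum>c\<in>inner_faces_x N. (case c of (i, j, k) \<Rightarrow> (p (i + 1, j, k) - p (i, j, k)) * w (X_axis, i, j, k))) / h"
    unfolding sum_divide_distrib
    by (intro sum.cong refl) (auto simp: face_grad_def faces_def grad_h_def)
  also have "(\<Sum>c\<in>inner_faces_x N. (case c of (i, j, k) \<Rightarrow> (p (i + 1, j, k) - p (i, j, k)) * w (X_axis, i, j, k)))
      = (\<Sum>j=1..N. \<Sum>k=1..N. - (\<Sum>i=1..N. ?x (i, j, k)))"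
    unfolding inner_faces_x_def sum_box_x prod.case
    by (intro sum.cong refl sum_difference_by_parts[of N "\<lambda>i. w (X_axis, i, _, _)" "\<lambda>i. p (i, _, _)"] N w0)
  also have "\<dots> = - (\<Sum>c\<in>?I. ?x c)"
    unfolding interior_cells_def sum_box_x by (simp only: sum_negf)
  finally have 1: "(\<Sum>c\<in>inner_faces_x N. face_grad N h p (X_axis, c) * w (X_axis, c)) = - (\<Sum>c\<in>?I. ?x c) / h" .
  have "(\<Sum>c\<in>inner_faces_y N. face_grad N h p (Y_axis, c) * w (Y_axis, c))
      = (\<Sum>c\<in>inner_faces_y N. (case c of (i, j, k) \<Rightarrow> (p (i, j + 1, k) - p (i, j, k)) * w (Y_axis, i, j, k))) / h"
    unfolding sum_divide_distrib
    by (intro sum.cong refl) (auto simp: face_grad_def faces_def grad_h_def)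
  also have "(\<Sum>c\<in>inner_faces_y N. (case c of (i, j, k) \<Rightarrow> (p (i, j + 1, k) - p (i, j, k)) * w (Y_axis, i, j, k)))
      = (\<Sum>i=1..N. \<Sum>k=1..N. - (\<Sum>j=1..N. ?y (i, j, k)))"
    unfolding inner_faces_y_def sum_box_y prod.case
    by (intro sum.cong refl sum_difference_by_parts[of N "\<lambda>j. w (Y_axis, _, j, _)" "\<lambda>j. p (_, j, _)"] N w0)
  also have "\<dots> = - (\<Sum>c\<in>?I. ?y c)"
    unfolding interior_cells_def sum_box_y by (simp only: sum_negf)
  finally have 2: "(\<Sum>c\<in>inner_faces_y N. face_grad N h p (Y_axis, c) * w (Y_axis, c)) = - (\<Sum>c\<in>?I. ?y c) / h" .
  have "(\<Sum>c\<in>inner_faces_z N. face_grad N h p (Z_axis, c) * w (Z_axis, c))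
      = (\<Sum>c\<in>inner_faces_z N. (case c of (i, j, k) \<Rightarrow> (p (i, j, k + 1) - p (i, j, k)) * w (Z_axis, i, j, k))) / h"
    unfolding sum_divide_distrib
    by (intro sum.cong refl) (auto simp: face_grad_def faces_def grad_h_def)
  also have "(\<Sum>c\<in>inner_faces_z N. (case c of (i, j, k) \<Rightarrow> (p (i, j, k + 1) - p (i, j, k)) * w (Z_axis, i, j, k)))
      = (\<Sum>i=1..N. \<Sum>j=1..N. - (\<Sum>k=1..N. ?z (i, j, k)))"
    unfolding inner_faces_z_def sum_box prod.case
    by (intro sum.cong refl sum_difference_by_parts[of N "\<lambda>k. w (Z_axis, _, _, k)" "\<lambda>k. p (_, _, k)"] N w0)
  also have "\<dots> = - (\<Sum>c\<in>?I. ?z c)"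
    unfolding interior_cells_def sum_box by (simp only: sum_negf)
  finally have 3: "(\<Sum>c\<in>inner_faces_z N. face_grad N h p (Z_axis, c) * w (Z_axis, c)) = - (\<Sum>c\<in>?I. ?z c) / h" .
  have "p c * face_div h w c = (?x c + ?y c + ?z c) / h" for c
    by (cases c) (simp add: face_div_def fields_def add_divide_distrib distrib_left)
  then have "(\<Sum>c\<in>?I. p c * face_div h w c) = ((\<Sum>c\<in>?I. ?x c) + (\<Sum>c\<in>?I. ?y c) + (\<Sum>c\<in>?I. ?z c)) / h"
    by (simp only: sum.distrib flip: sum_divide_distrib)
  then show ?thesis
    unfolding sum_faces 1 2 3 by (simp add: add_divide_distrib)
qed

lemma chain_constant:
  fixes q :: "nat \<Rightarrow> 'a"
  assumes "\<And>i. 1 \<le> i \<Longrightarrow> i < N \<Longrightarrow> q (i + 1) = q i" "i \<in> {1..N}"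
  shows "q i = q 1"
  using assms(2)
proof (induction i)
  case (Suc i)
  then show ?case using assms(1)[of i] by (cases "i = 0") auto
qed simp

text \<open>Connectedness: an axis-parallel path through inner faces joins each cell to the corner
  cell.\<close>

lemma face_grad_kernel:
  assumes h: "h \<noteq> 0" and 0: "\<And>e. e \<in> faces N \<Longrightarrow> face_grad N h p e = 0" and c: "c \<in> interior_cells N"
  shows "p c = p (1, 1, 1)"
proof -
  obtain i j k where ijk: "c = (i, j, k)" by (cases c)
  have r: "i \<in> {1..N}" "j \<in> {1..N}" "k \<in> {1..N}" "1 \<in> {1..N}"
    using c by (auto simp: ijk interior_cells_def)
  have "p (i, j, k) = p (1, j, k)"
  proof (rule chain_constant[of N "\<lambda>i. p (i, j, k)"])
    fix i assume "1 \<le> i" "i < N"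
    then show "p (i + 1, j, k) = p (i, j, k)"
      using 0[of "(X_axis, i, j, k)"] h r by (simp add: in_faces_iff face_grad_def grad_h_def)
  qed (rule r)
  also have "\<dots> = p (1, 1, k)"
  proof (rule chain_constant[of N "\<lambda>j. p (1, j, k)"])
    fix j assume "1 \<le> j" "j < N"
    then show "p (1, j + 1, k) = p (1, j, k)"
      using 0[of "(Y_axis, 1, j, k)"] h r by (simp add: in_faces_iff face_grad_def grad_h_def)
  qed (rule r)
  also have "\<dots> = p (1, 1, 1)"
  proof (rule chain_constant[of N "\<lambda>k. p (1, 1, k)"])
    fix k assume "1 \<le> k" "k < N"
    then show "p (1, 1, k + 1) = p (1, 1, k)"
      using 0[of "(Z_axis, 1, 1, k)"] h r by (simp add: in_faces_iff face_grad_def grad_h_def)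
  qed (rule r)
  finally show ?thesis by (simp add: ijk)
qed

lemma staggered_system_grid:
  assumes N: "N > 0" and h: "h \<noteq> 0"
  shows "staggered_system (interior_cells N) (faces N) (face_div h) (face_grad N h) (face_diffusion N h)"
proof
  show "finite (interior_cells N)" by (simp add: interior_cells_def)
  show "finite (faces N)" by (rule finite_faces)
  show "interior_cells N \<noteq> {}" using N by (auto simp: interior_cells_def)
  show "face_div h (\<lambda>e. x e + t * y e) c = face_div h x c + t * face_div h y c" for x y t c
    using h by (cases c) (simp add: face_div_def fields_def field_simps)
  show "face_grad N h (\<lambda>c. p c + t * q c) e = face_grad N h p e + t * face_grad N h q e" for p q t e
    using h by (cases e; cases "fst e") (auto simp: face_grad_def grad_h_def field_simps)
  show "face_diffusion N h (\<lambda>e. x e + t * y e) e = face_diffusion N h x e + t * face_diffusion N h y e"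
    for x y t e
    using h by (cases e; cases "fst e") (auto simp: face_diffusion_def extend_def field_simps)
  show "continuous_on UNIV (\<lambda>w. face_div h w c)" for c
    using h by (cases c)
      (auto simp: face_div_def fields_def intro!: continuous_intros continuous_on_product_coordinates)
  show "continuous_on UNIV (\<lambda>p. face_grad N h p e)" for e
  proof (cases "e \<in> faces N")
    case True
    then show ?thesis
      using h by (cases e; cases "fst e")
        (auto simp: face_grad_def grad_h_def intro!: continuous_intros continuous_on_product_coordinates)
  qed (simp add: face_grad_def)
  show "continuous_on UNIV (\<lambda>w. face_diffusion N h w e)" for e
    using h by (cases e; cases "fst e")
      (auto simp: face_diffusion_def extend_def intro!: continuous_intros continuous_on_product_coordinates)
  show "face_grad N h p e = 0" if "e \<notin> faces N" for p e
    using that by (simp add: face_grad_def)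
  show "(\<Sum>e\<in>faces N. face_grad N h p e * w e) = - (\<Sum>c\<in>interior_cells N. p c * face_div h w c)"
    if "\<And>e. e \<notin> faces N \<Longrightarrow> w e = 0" for p w
    using sum_face_grad[where w = w, OF N that] .
  show "face_grad N h (\<lambda>_. t) e = 0" for t e
    by (cases e; cases "fst e") (auto simp: face_grad_def grad_h_def)
  show "p c = p c'" if "\<And>e. e \<in> faces N \<Longrightarrow> face_grad N h p e = 0"
      "c \<in> interior_cells N" "c' \<in> interior_cells N" for p c c'
    using face_grad_kernel[OF h that(1,2)] face_grad_kernel[OF h that(1,3)] by simp
  show "(\<Sum>e\<in>faces N. face_diffusion N h x e * y e) = (\<Sum>e\<in>faces N. x e * face_diffusion N h y e)"
    if "\<And>e. e \<notin> faces N \<Longrightarrow> x e = 0" "\<And>e. e \<notin> faces N \<Longrightarrow> y e = 0" for x y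
  proof -
    have "(\<Sum>e\<in>faces N. face_diffusion N h x e * y e) = (\<Sum>e\<in>faces N. face_diffusion N h y e * x e)"
      using sum_face_diffusion[where h = h and x = x and y = y, OF N that(2)]
        sum_face_diffusion[where h = h and x = y and y = x, OF N that(1)]
      by (simp add: dirichlet_form_commute)
    then show ?thesis by (simp add: mult.commute)
  qed
  show "(\<Sum>e\<in>faces N. x e * face_diffusion N h x e) \<ge> 0"
    if "\<And>e. e \<notin> faces N \<Longrightarrow> x e = 0" for x
  proof -
    have "(\<Sum>e\<in>faces N. face_diffusion N h x e * x e) \<ge> 0"
      by (subst sum_face_diffusion[where y = x, OF N that])
        (intro add_nonneg_nonneg divide_nonneg_nonneg dirichlet_form_nonneg that | simp)+
    then show ?thesis by (simp add: mult.commute)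
  qed
qed

section \<open>Boundary conditions and the translation of the scheme\<close>

text \<open>In each component \<open>i\<close> is the normal index. The range contains all points
  that the operators read at interior cells and inner faces; agreement beyond it would fail for
  restricted functions.\<close>

definition matches :: "nat \<Rightarrow> vfield \<Rightarrow> vfield \<Rightarrow> bool" where
  "matches N u u' \<longleftrightarrow>
    (\<forall>i\<in>{0..N}. \<forall>j\<in>{0..N+1}. \<forall>k\<in>{0..N+1}.
      component X_axis u (i, j, k) = component X_axis u' (i, j, k) \<and>
      component Y_axis u (j, i, k) = component Y_axis u' (j, i, k) \<and>
      component Z_axis u (j, k, i) = component Z_axis u' (j, k, i))"

text \<open>The indices are clamped one at a time; this reaches edge and corner ghosts because
  \<open>neumann_bc\<close> lets tangential indices be ghosts.\<close>

lemma cell_clamp: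
  assumes N: "N > 0" and bc: "neumann_bc N \<phi>" and r: "i \<le> N + 1" "j \<le> N + 1" "k \<le> N + 1"
  shows "\<phi> (i, j, k) = \<phi> (clamp_index N i, clamp_index N j, clamp_index N k)"
proof -
  have cases: "m = 0 \<or> m = N + 1 \<or> clamp_index N m = m" if "m \<le> N + 1" for m
    using that by (auto simp: clamp_index_def)
  have le: "clamp_index N m \<le> N + 1" for m
    using clamp_index_range[OF N, of m] by simp
  note bd = clamp_index_boundary[OF N]
  have "\<phi> (i, j, k) = \<phi> (clamp_index N i, j, k)"
    using cases[OF r(1)] bc r(2,3) by (auto simp: neumann_bc_def bd)
  also have "\<dots> = \<phi> (clamp_index N i, clamp_index N j, k)"
    using cases[OF r(2)] bc le[of i] r(3) by (auto simp: neumann_bc_def bd)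
  also have "\<dots> = \<phi> (clamp_index N i, clamp_index N j, clamp_index N k)"
    using cases[OF r(3)] bc le[of i] le[of j] by (auto simp: neumann_bc_def bd)
  finally show ?thesis .
qed

lemma cell_funs_eqI:
  assumes N: "N > 0" and "\<phi> \<in> cell_funs N" "\<psi> \<in> cell_funs N" "neumann_bc N \<phi>" "neumann_bc N \<psi>"
    and eq: "\<And>c. c \<in> interior_cells N \<Longrightarrow> \<phi> c = \<psi> c"
  shows "\<phi> = \<psi>"
proof (rule PiE_ext)
  show "\<phi> \<in> ({0..N+1} \<times> {0..N+1} \<times> {0..N+1}) \<rightarrow>\<^sub>E UNIV" "\<psi> \<in> ({0..N+1} \<times> {0..N+1} \<times> {0..N+1}) \<rightarrow>\<^sub>E UNIV"
    using assms by (auto simp: cell_funs_def)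
  fix c assume "c \<in> {0..N+1} \<times> {0..N+1} \<times> {0..N+1}"
  then obtain i j k where c: "c = (i, j, k)" "i \<le> N + 1" "j \<le> N + 1" "k \<le> N + 1"
    by auto
  have "(clamp_index N i, clamp_index N j, clamp_index N k) \<in> interior_cells N"
    using clamp_index_range[OF N] by (simp add: interior_cells_def)
  then show "\<phi> c = \<psi> c"
    unfolding c(1) cell_clamp[OF N assms(4) c(2-4)] cell_clamp[OF N assms(5) c(2-4)] by (rule eq)
qed

definition cell_extension :: "nat \<Rightarrow> grid \<Rightarrow> grid" where
  "cell_extension N \<phi> = restrict (\<lambda>(i, j, k). \<phi> (clamp_index N i, clamp_index N j, clamp_index N k))
    ({0..N+1} \<times> {0..N+1} \<times> {0..N+1})"

lemma cell_extension:
  assumes "N > 0"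
  shows "cell_extension N \<phi> \<in> cell_funs N" "neumann_bc N (cell_extension N \<phi>)"
    "c \<in> interior_cells N \<Longrightarrow> cell_extension N \<phi> c = \<phi> c"
proof -
  show "cell_extension N \<phi> \<in> cell_funs N"
    by (auto simp: cell_extension_def cell_funs_def)
  show "neumann_bc N (cell_extension N \<phi>)"
    using assms by (auto simp: cell_extension_def neumann_bc_def clamp_index_boundary)
  show "c \<in> interior_cells N \<Longrightarrow> cell_extension N \<phi> c = \<phi> c"
    by (auto simp: cell_extension_def interior_cells_def clamp_index_id)
qed

definition field_extension :: "nat \<Rightarrow> (axis \<times> nat \<times> nat \<times> nat \<Rightarrow> real) \<Rightarrow> vfield" where
  "field_extension N w =
    (restrict (component X_axis (extend N w)) ({0..N} \<times> {0..N+1} \<times> {0..N+1}),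
     restrict (component Y_axis (extend N w)) ({0..N+1} \<times> {0..N} \<times> {0..N+1}),
     restrict (component Z_axis (extend N w)) ({0..N+1} \<times> {0..N+1} \<times> {0..N}))"

lemma field_extension:
  assumes N: "N > 0" and w: "\<And>e. e \<notin> faces N \<Longrightarrow> w e = 0"
  shows "field_extension N w \<in> face_fields N" "no_penetration N (field_extension N w)"
    "free_slip N (field_extension N w)" "matches N (field_extension N w) (extend N w)"
proof -
  have w0: "w (X_axis, 0, j, k) = 0" "w (X_axis, N, j, k) = 0" "w (Y_axis, j, 0, k) = 0"
    "w (Y_axis, j, N, k) = 0" "w (Z_axis, j, k, 0) = 0" "w (Z_axis, j, k, N) = 0" for j k
    by (rule w, simp add: in_faces_iff)+
  show "field_extension N w \<in> face_fields N"
    by (auto simp: field_extension_def face_fields_def face_funs_x_def face_funs_y_def face_funs_z_def)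
  show "no_penetration N (field_extension N w)"
    by (auto simp: field_extension_def extend_def w0)
  show "free_slip N (field_extension N w)"
    using N by (auto simp: field_extension_def extend_def clamp_index_boundary)
  show "matches N (field_extension N w) (extend N w)"
    by (auto simp: matches_def field_extension_def)
qed

definition face_values :: "nat \<Rightarrow> vfield \<Rightarrow> axis \<times> nat \<times> nat \<times> nat \<Rightarrow> real" where
  "face_values N u e = (if e \<in> faces N then component (fst e) u (snd e) else 0)"

text \<open>Free slip clamps the tangential indices, and no penetration makes the cut-off to inner
  faces lose nothing.\<close>

lemma matches_face_values:
  assumes N: "N > 0" and np: "no_penetration N u" and fs: "free_slip N u"
  shows "matches N u (extend N (face_values N u))"
proof -
  obtain fx fy fz where u: "u = (fx, fy, fz)" by (cases u)
  have cases: "m = 0 \<or> m = N + 1 \<or> clamp_index N m = m" if "m \<le> N + 1" for m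
    using that by (auto simp: clamp_index_def)
  have cl: "1 \<le> clamp_index N m" "clamp_index N m \<le> N" for m
    using clamp_index_range[OF N, of m] by simp_all
  have le: "clamp_index N m \<le> N + 1" for m
    using cl(2)[of m] by simp
  note bd = clamp_index_boundary[OF N]
  have fsx: "fx (i, j, k) = fx (i, clamp_index N j, clamp_index N k)"
    and fsy: "fy (j, i, k) = fy (clamp_index N j, i, clamp_index N k)"
    and fsz: "fz (j, k, i) = fz (clamp_index N j, clamp_index N k, i)"
    if "i \<le> N" "j \<le> N + 1" "k \<le> N + 1" for i j k
  proof -
    have "fx (i, j, k) = fx (i, clamp_index N j, k)"
      using cases[OF that(2)] fs that unfolding u by (auto simp: bd)
    also have "\<dots> = fx (i, clamp_index N j, clamp_index N k)"
      using cases[OF that(3)] fs that le[of j] unfolding u by (auto simp: bd)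
    finally show "fx (i, j, k) = fx (i, clamp_index N j, clamp_index N k)" .
    have "fy (j, i, k) = fy (clamp_index N j, i, k)"
      using cases[OF that(2)] fs that unfolding u by (auto simp: bd)
    also have "\<dots> = fy (clamp_index N j, i, clamp_index N k)"
      using cases[OF that(3)] fs that le[of j] unfolding u by (auto simp: bd)
    finally show "fy (j, i, k) = fy (clamp_index N j, i, clamp_index N k)" .
    have "fz (j, k, i) = fz (clamp_index N j, k, i)"
      using cases[OF that(2)] fs that unfolding u by (auto simp: bd)
    also have "\<dots> = fz (clamp_index N j, clamp_index N k, i)"
      using cases[OF that(3)] fs that le[of j] unfolding u by (auto simp: bd)
    finally show "fz (j, k, i) = fz (clamp_index N j, clamp_index N k, i)" .
  qed
  have vx: "fx (i, clamp_index N j, clamp_index N k)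
      = face_values N u (X_axis, i, clamp_index N j, clamp_index N k)"
    and vy: "fy (clamp_index N j, i, clamp_index N k)
      = face_values N u (Y_axis, clamp_index N j, i, clamp_index N k)"
    and vz: "fz (clamp_index N j, clamp_index N k, i)
      = face_values N u (Z_axis, clamp_index N j, clamp_index N k, i)"
    if "i \<le> N" for i j k
  proof -
    have i: "i = 0 \<or> i = N \<or> 1 \<le> i \<and> i < N" using that by auto
    show "fx (i, clamp_index N j, clamp_index N k)
        = face_values N u (X_axis, i, clamp_index N j, clamp_index N k)"
      "fy (clamp_index N j, i, clamp_index N k)
        = face_values N u (Y_axis, clamp_index N j, i, clamp_index N k)"
      "fz (clamp_index N j, clamp_index N k, i)
        = face_values N u (Z_axis, clamp_index N j, clamp_index N k, i)"
      using np i cl[of j] cl[of k] by (auto simp: u face_values_def in_faces_iff)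
  qed
  have "fx (i, j, k) = face_values N u (X_axis, i, clamp_index N j, clamp_index N k)"
    "fy (j, i, k) = face_values N u (Y_axis, clamp_index N j, i, clamp_index N k)"
    "fz (j, k, i) = face_values N u (Z_axis, clamp_index N j, clamp_index N k, i)"
    if "i \<le> N" "j \<le> N + 1" "k \<le> N + 1" for i j k
    using fsx[OF that] fsy[OF that] fsz[OF that] vx[OF that(1)] vy[OF that(1)] vz[OF that(1)]
    by simp_all
  then show ?thesis
    by (simp add: matches_def u extend_def)
qed

lemma matchesD:
  assumes "matches N u u'" "i \<le> N" "j \<le> N + 1" "k \<le> N + 1"
  shows "component X_axis u (i, j, k) = component X_axis u' (i, j, k)"
    "component Y_axis u (j, i, k) = component Y_axis u' (j, i, k)"
    "component Z_axis u (j, k, i) = component Z_axis u' (j, k, i)"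
  using assms by (auto simp: matches_def)

text \<open>On a boundary face the Neumann condition makes the difference quotient 0, which is the
  value that \<open>face_grad\<close> prescribes.\<close>

lemma cell_laplacian_face_div:
  assumes N: "N > 0" and bc: "neumann_bc N \<phi>" and c: "c \<in> interior_cells N"
  shows "cell_laplacian h \<phi> c = face_div h (face_grad N h \<phi>) c"
proof -
  obtain i j k where ijk: "c = (i, j, k)" by (cases c)
  have r: "1 \<le> i" "i \<le> N" "1 \<le> j" "j \<le> N" "1 \<le> k" "k \<le> N"
    using c by (auto simp: ijk interior_cells_def)
  have D: "cell_to_face_Dx h \<phi> (m, j, k) = face_grad N h \<phi> (X_axis, m, j, k)"
    "cell_to_face_Dy h \<phi> (i, m, k) = face_grad N h \<phi> (Y_axis, i, m, k)"
    "cell_to_face_Dz h \<phi> (i, j, m) = face_grad N h \<phi> (Z_axis, i, j, m)" if "m \<le> N" for m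
  proof -
    have "m = 0 \<or> m = N \<or> 1 \<le> m \<and> m < N" using that by auto
    then show "cell_to_face_Dx h \<phi> (m, j, k) = face_grad N h \<phi> (X_axis, m, j, k)"
      "cell_to_face_Dy h \<phi> (i, m, k) = face_grad N h \<phi> (Y_axis, i, m, k)"
      "cell_to_face_Dz h \<phi> (i, j, m) = face_grad N h \<phi> (Z_axis, i, j, m)"
      using r bc by (auto simp: face_grad_def in_faces_iff grad_h_def neumann_bc_def)
  qed
  have "i - 1 \<le> N" "j - 1 \<le> N" "k - 1 \<le> N" using r by auto
  with r show ?thesis
    by (simp add: ijk cell_laplacian_def face_div_def fields_def grad_h_def D
        del: cell_to_face_Dx.simps cell_to_face_Dy.simps cell_to_face_Dz.simps)
qed

lemma div_h_face_div:
  assumes m: "matches N u (extend N w)" and c: "c \<in> interior_cells N"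
  shows "div_h h u c = face_div h w c"
    and "div_h h (field_times (avg_h \<phi>) u) c = face_div h (\<lambda>e. component (fst e) (avg_h \<phi>) (snd e) * w e) c"
proof -
  obtain i j k where ijk: "c = (i, j, k)" by (cases c)
  obtain ux uy uz where u: "u = (ux, uy, uz)" by (cases u)
  have r: "1 \<le> i" "i \<le> N" "1 \<le> j" "j \<le> N" "1 \<le> k" "k \<le> N"
    using c by (auto simp: ijk interior_cells_def)
  have W: "ux (m, j, k) = w (X_axis, m, j, k)" "uy (i, m, k) = w (Y_axis, i, m, k)"
      "uz (i, j, m) = w (Z_axis, i, j, m)" if "m \<le> N" for m
    using matchesD(1)[OF m that, of j k] matchesD(2)[OF m that, of i k] matchesD(3)[OF m that, of i j] r
    by (simp_all add: u extend_def clamp_index_id)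
  have "i - 1 \<le> N" "j - 1 \<le> N" "k - 1 \<le> N" using r by auto
  note W' = W[OF this(1)] W[OF this(2)] W[OF this(3)] W[OF r(2)] W[OF r(4)] W[OF r(6)]
  show "div_h h u c = face_div h w c"
    by (simp add: ijk u face_div_def fields_def W'[unfolded One_nat_def])
  show "div_h h (field_times (avg_h \<phi>) u) c
      = face_div h (\<lambda>e. component (fst e) (avg_h \<phi>) (snd e) * w e) c"
    by (simp add: ijk u face_div_def fields_def avg_h_def W'[unfolded One_nat_def])
qed

lemma face_laplacian_face_diffusion:
  assumes m: "matches N u (extend N w)" and e: "e \<in> faces N"
  shows "- face_laplacian h (component (fst e) u) (snd e) = face_diffusion N h w e"
    and "component (fst e) u (snd e) = w e"
proof -
  obtain d i j k where e': "e = (d, i, j, k)" by (cases e)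
  have M: "component X_axis u (i', j', k') = component X_axis (extend N w) (i', j', k')"
    if "i' \<le> N" "j' \<le> N + 1" "k' \<le> N + 1" for i' j' k'
    using matchesD(1)[OF m that] .
  have M2: "component Y_axis u (i', j', k') = component Y_axis (extend N w) (i', j', k')"
    if "i' \<le> N + 1" "j' \<le> N" "k' \<le> N + 1" for i' j' k'
    using matchesD(2)[OF m that(2,1,3)] .
  have M3: "component Z_axis u (i', j', k') = component Z_axis (extend N w) (i', j', k')"
    if "i' \<le> N + 1" "j' \<le> N + 1" "k' \<le> N" for i' j' k'
    using matchesD(3)[OF m that(3,1,2)] .
  show "- face_laplacian h (component (fst e) u) (snd e) = face_diffusion N h w e"
    using e by (cases d) (auto simp: e' in_faces_iff face_diffusion_def M M2 M3)
  show "component (fst e) u (snd e) = w e"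
    using e by (cases d) (auto simp: e' in_faces_iff M M2 M3, auto simp: extend_def clamp_index_id)
qed

lemma all_axis: "(\<forall>d. P d) \<longleftrightarrow> P X_axis \<and> P Y_axis \<and> P Z_axis"
  by (metis axis.exhaust)

lemma stokes_equation_iff:
  assumes m: "matches N u (extend N w)"
  shows "stokes_equation N h \<gamma> u (grad_h h p) (field_times (avg_h \<phi>) (grad_h h \<mu>)) \<longleftrightarrow>
    (\<forall>e\<in>faces N. face_diffusion N h w e + w e + face_grad N h p e
      + \<gamma> * (component (fst e) (avg_h \<phi>) (snd e) * face_grad N h \<mu> e) = 0)"
proof -
  obtain ux uy uz where u: "u = (ux, uy, uz)" by (cases u)
  have "stokes_equation N h \<gamma> u (grad_h h p) (field_times (avg_h \<phi>) (grad_h h \<mu>)) \<longleftrightarrow>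
    (\<forall>d. \<forall>c\<in>inner_faces N d. - face_laplacian h (component d u) c + component d u c
      + component d (grad_h h p) c + \<gamma> * (component d (avg_h \<phi>) c * component d (grad_h h \<mu>) c) = 0)"
    unfolding all_axis by (simp add: u grad_h_def avg_h_def stokes_component_def)
  also have "\<dots> \<longleftrightarrow> (\<forall>e\<in>faces N. - face_laplacian h (component (fst e) u) (snd e)
      + component (fst e) u (snd e) + component (fst e) (grad_h h p) (snd e)
      + \<gamma> * (component (fst e) (avg_h \<phi>) (snd e) * component (fst e) (grad_h h \<mu>) (snd e)) = 0)"
    by (auto simp: faces_def simp del: face_laplacian.simps)
  also have "\<dots> \<longleftrightarrow> (\<forall>e\<in>faces N. face_diffusion N h w e + w e + face_grad N h p e
      + \<gamma> * (component (fst e) (avg_h \<phi>) (snd e) * face_grad N h \<mu> e) = 0)"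
    by (intro ball_cong refl) (simp only: face_laplacian_face_diffusion[OF m] face_grad_def if_True)
  finally show ?thesis .
qed

text \<open>The bridge between grid and abstract system, crossed from right to left for existence
  and from left to right for uniqueness.\<close>

lemma scheme_iff_solution:
  assumes N: "N > 0" and h: "h \<noteq> 0" and bc: "neumann_bc N \<phi>" "neumann_bc N \<mu>"
    and m: "matches N u (extend N w)" and w: "\<And>e. e \<notin> faces N \<Longrightarrow> w e = 0"
  shows "scheme N h s \<gamma> \<epsilon> \<theta> \<phi>n \<phi> \<mu> u p \<longleftrightarrow>
    staggered_system.solution (interior_cells N) (faces N) (face_div h) (face_grad N h) (face_diffusion N h)
      s \<gamma> \<epsilon> \<theta> (\<lambda>e. component (fst e) (avg_h \<phi>n) (snd e)) \<phi>n \<phi> \<mu> w p"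
proof -
  interpret staggered_system "interior_cells N" "faces N" "face_div h" "face_grad N h" "face_diffusion N h"
    by (rule staggered_system_grid[OF N h])
  have "w \<in> V" using w by (simp add: V_def)
  then show ?thesis
    unfolding scheme_def solution_def stokes_equation_iff[OF m]
    using cell_laplacian_face_div[OF N bc(1)] cell_laplacian_face_div[OF N bc(2)] div_h_face_div[OF m]
    by simp
qed

theorem theorem3p1:
  fixes \<gamma> \<epsilon> \<theta>\<^sub>0 L h s M \<beta> :: real and N :: nat and \<phi>n :: grid
  assumes "\<gamma> > 0" and "\<epsilon> > 0" and "\<theta>\<^sub>0 > 0" and "L > 0" and "N > 0"
    and "h = L / real N" and "s > 0"
    and "\<phi>n \<in> cell_funs N"
    and "M > 0" and "sup_norm N \<phi>n \<le> M"
    and "cell_mean N L \<phi>n = \<beta>" and "\<beta> \<in> {-1<..<1}"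
  shows "\<exists>!\<phi>. \<phi> \<in> cell_funs N \<and> neumann_bc N \<phi> \<and>
    (\<exists>\<mu>\<in>cell_funs N. \<exists>p\<in>cell_funs N. \<exists>u\<in>face_fields N.
      neumann_bc N \<mu> \<and> neumann_bc N p \<and> no_penetration N u \<and> free_slip N u \<and>
      scheme N h s \<gamma> \<epsilon> \<theta>\<^sub>0 \<phi>n \<phi> \<mu> u p) \<and>
    cell_inner N h (\<lambda>c. \<phi> c - \<phi>n c) (\<lambda>_. 1) = 0 \<and>
    sup_norm N \<phi> < 1"
proof -
  note N = \<open>N > 0\<close> and hL = \<open>h = L / real N\<close> and L = \<open>L > 0\<close>
  have h: "h \<noteq> 0" using N L by (simp add: hL)
  define a where "a e = component (fst e) (avg_h \<phi>n) (snd e)" for e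
  interpret staggered_system "interior_cells N" "faces N" "face_div h" "face_grad N h" "face_diffusion N h"
    by (rule staggered_system_grid[OF N h])
  have card: "card (interior_cells N) = N ^ 3"
    by (simp add: interior_cells_def card_cartesian_product power3_eq_cube)
  interpret discrete_problem "interior_cells N" "faces N" "face_div h" "face_grad N h" "face_diffusion N h"
    s \<gamma> \<epsilon> \<theta>\<^sub>0 \<beta> a \<phi>n
  proof
    \<comment> \<open>Because h^3 / L^3 = 1 / N^3, the mean is the arithmetic one.\<close>
    have "(\<Sum>c\<in>interior_cells N. \<phi>n c) / real N ^ 3 = \<beta>"
      using assms(11) L by (simp add: cell_mean_def cell_inner_def hL field_simps)
    then show "(\<Sum>c\<in>interior_cells N. \<phi>n c) = \<beta> * real (card (interior_cells N))"
      using N by (simp add: card field_simps)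
  qed (use assms in auto)
  have sup: "sup_norm N \<phi> < 1 \<longleftrightarrow> (\<forall>c\<in>interior_cells N. \<bar>\<phi> c\<bar> < 1)" for \<phi>
    unfolding sup_norm_def using fin_C C_ne by (subst Max_less_iff) auto
  have scheme: "scheme N h s \<gamma> \<epsilon> \<theta>\<^sub>0 \<phi>n \<phi> \<mu> u p \<longleftrightarrow> solution s \<gamma> \<epsilon> \<theta>\<^sub>0 a \<phi>n \<phi> \<mu> w p"
    if "neumann_bc N \<phi>" "neumann_bc N \<mu>" "matches N u (extend N w)" "w \<in> V" for \<phi> \<mu> u w p
    unfolding a_def[abs_def] using that(1-3) that(4)[unfolded V_def]
    by (intro scheme_iff_solution[OF N h]) blast+
  obtain \<phi> \<mu> w p where sol: "solution s \<gamma> \<epsilon> \<theta>\<^sub>0 a \<phi>n \<phi> \<mu> w p"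
    and int: "\<And>c. c \<in> interior_cells N \<Longrightarrow> \<bar>\<phi> c\<bar> < 1"
    using ex_solution by blast
  let ?E = "cell_extension N" and ?u = "field_extension N w"
  note E = cell_extension[OF N]
  have w: "w \<in> V" using sol by (simp add: solution_def)
  have w0: "w e = 0" if "e \<notin> faces N" for e using w that unfolding V_def by blast
  \<comment> \<open>The abstract solution has arbitrary values off the interior cells; these are
    replaced by reflected ones.\<close>
  have sol': "solution s \<gamma> \<epsilon> \<theta>\<^sub>0 a \<phi>n (?E \<phi>) (?E \<mu>) w (?E p)"
    using sol by (rule solution_cong[rotated 3]) (simp_all add: E(3))
  show ?thesis
  proof (rule ex1I[of _ "?E \<phi>"])
    have "scheme N h s \<gamma> \<epsilon> \<theta>\<^sub>0 \<phi>n (?E \<phi>) (?E \<mu>) ?u (?E p)"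
      using scheme[OF E(2) E(2) field_extension(4)[OF N w0] w] sol' by simp
    then have "\<exists>\<mu>\<in>cell_funs N. \<exists>p\<in>cell_funs N. \<exists>u\<in>face_fields N.
      neumann_bc N \<mu> \<and> neumann_bc N p \<and> no_penetration N u \<and> free_slip N u \<and>
      scheme N h s \<gamma> \<epsilon> \<theta>\<^sub>0 \<phi>n (?E \<phi>) \<mu> u p"
      by (intro bexI[of _ "?E \<mu>"] bexI[of _ "?E p"] bexI[of _ ?u] conjI E(1,2)
          field_extension(1-3)[OF N w0])
    moreover have "cell_inner N h (\<lambda>c. ?E \<phi> c - \<phi>n c) (\<lambda>_. 1) = 0"
      using solution_mass[OF sol'] by (simp add: cell_inner_def)
    moreover have "sup_norm N (?E \<phi>) < 1"
      using int by (simp add: sup E(3))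
    ultimately show "?E \<phi> \<in> cell_funs N \<and> neumann_bc N (?E \<phi>) \<and>
      (\<exists>\<mu>\<in>cell_funs N. \<exists>p\<in>cell_funs N. \<exists>u\<in>face_fields N.
        neumann_bc N \<mu> \<and> neumann_bc N p \<and> no_penetration N u \<and> free_slip N u \<and>
        scheme N h s \<gamma> \<epsilon> \<theta>\<^sub>0 \<phi>n (?E \<phi>) \<mu> u p) \<and>
      cell_inner N h (\<lambda>c. ?E \<phi> c - \<phi>n c) (\<lambda>_. 1) = 0 \<and> sup_norm N (?E \<phi>) < 1"
      by (intro conjI E(1,2))
  next
    fix \<psi>
    assume \<psi>: "\<psi> \<in> cell_funs N \<and> neumann_bc N \<psi> \<and>
      (\<exists>\<mu>\<in>cell_funs N. \<exists>p\<in>cell_funs N. \<exists>u\<in>face_fields N.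
        neumann_bc N \<mu> \<and> neumann_bc N p \<and> no_penetration N u \<and> free_slip N u \<and>
        scheme N h s \<gamma> \<epsilon> \<theta>\<^sub>0 \<phi>n \<psi> \<mu> u p) \<and>
      cell_inner N h (\<lambda>c. \<psi> c - \<phi>n c) (\<lambda>_. 1) = 0 \<and> sup_norm N \<psi> < 1"
    then obtain \<mu>' p' u' where sch: "neumann_bc N \<mu>'" "no_penetration N u'" "free_slip N u'"
        "scheme N h s \<gamma> \<epsilon> \<theta>\<^sub>0 \<phi>n \<psi> \<mu>' u' p'"
      by auto
    have "face_values N u' \<in> V"
      unfolding V_def by (simp add: face_values_def)
    then have sol_\<psi>: "solution s \<gamma> \<epsilon> \<theta>\<^sub>0 a \<phi>n \<psi> \<mu>' (face_values N u') p'"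
      using scheme[OF _ sch(1) matches_face_values[OF N sch(2,3)]] sch(4) \<psi> by simp
    show "\<psi> = ?E \<phi>"
    proof (rule cell_funs_eqI[OF N])
      fix c assume c: "c \<in> interior_cells N"
      show "\<psi> c = ?E \<phi> c"
      proof (rule solution_unique[OF s \<gamma> sol_\<psi> _ sol' _ c])
        show "\<bar>\<psi> c\<bar> < 1" if "c \<in> interior_cells N" for c
          using \<psi> sup that by blast
        show "\<bar>?E \<phi> c\<bar> < 1" if "c \<in> interior_cells N" for c
          using int[OF that] by (simp add: E(3)[OF that])
      qed
    qed (use \<psi> E(1,2) in \<open>simp_all only: simp_thms\<close>)
  qed
qed

end
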